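(* ${\cal G}_3={\cal H}_3$, where ${\cal G}_3$ is the set of all graphs $G$ such that $\nu_3(F)=\tau_3(F)$ for every induced subgraph $F$ of $G$, and ${\cal H}_3$ is the set of all graphs $G$ such that every non-trivial block $B$ of $G$ satisfies the following condition: $B=Sub_3(H)$ for some multigraph $H$, and every cutvertex of $G$ that belongs to $B$ is a vertex of $H$.
   Context: Graphs are finite, simple, and undirected. Multigraphs are finite and undirected and may contain loops and parallel edges. A $3$-path in a graph $G$ is a (not necessarily induced) path in $G$ with exactly $3$ vertices. $\nu_3(G)$ is the maximum cardinality of a set of pairwise vertex-disjoint $3$-paths in $G$, and $\tau_3(G)$ is the minimum cardinality of a set of vertices of $G$ intersecting every $3$-path in $G$. A cutvertex of $G$ is a vertex $x$ of $G$ such that $G-x$ has more components than $G$. A block of $G$ is a maximal connected subgraph $B$ of $G$ such that $B$ itself has no cutvertex. A block is trivial if it is either $K_1$ or $K_2$. For a positive integer $k$ and a multigraph $H$, the $k$-subdivision $Sub_k(H)$ arises from $H$ by subdividing every edge exactly $k-1$ times, that is, every edge between distinct vertices $u$ and $v$ is replaced by a path with $k+1$ vertices between $u$ and $v$ whose internal vertices have degree $2$, and every loop incident with a vertex $u$ is replaced by a cycle with $k$ vertices containing $u$ and $k-1$ further vertices of degree $2$. In particular $V(H)\subseteq V(Sub_k(H))$, and when $B=Sub_k(H)$ the vertices of $H$ are regarded as vertices of $B$. *)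

theory Defs
  imports "Graph_Theory.Graph_Theory"
begin

text \<open>
  A finite simple undirected graph is a \<^verbatim>\<open>graph\<close> in the sense of Graph_Theory:
  a finite symmetric digraph without loops and parallel arcs, every undirected edge
  being represented by its two arcs.
\<close>


subsection \<open>Packing and covering 3-paths\<close>

text \<open>
  A path and its reversal are different lists with the same vertex set.  This does not affect
  the packing number, as two such lists are never vertex-disjoint.
\<close>

definition three_paths :: "('a, 'b) pre_digraph \<Rightarrow> 'a list set" where
  "three_paths G = {p. vpath p G \<and> length p = 3}"

definition nu3 :: "('a, 'b) pre_digraph \<Rightarrow> nat" where
  "nu3 G = Max {card S | S. S \<subseteq> three_paths G \<and> pairwise (\<lambda>p q. set p \<inter> set q = {}) S}"

definition tau3 :: "('a, 'b) pre_digraph \<Rightarrow> nat" where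
  "tau3 G = Min {card X | X. X \<subseteq> verts G \<and> (\<forall>p \<in> three_paths G. set p \<inter> X \<noteq> {})}"


subsection \<open>Cutvertices and blocks\<close>

text \<open>
  On symmetric digraphs the strongly connected components are the components of the
  underlying undirected graph.
\<close>

definition cutvertex :: "('a, 'b) pre_digraph \<Rightarrow> 'a \<Rightarrow> bool" where
  "cutvertex G x \<longleftrightarrow> x \<in> verts G \<and>
     card (pre_digraph.sccs G) < card (pre_digraph.sccs (pre_digraph.del_vert G x))"

text \<open>
  Subgraphs in Graph_Theory need not be symmetric, hence the condition \<^verbatim>\<open>graph B'\<close>.
  The predicate \<^verbatim>\<open>connected\<close> excludes the empty graph.
\<close>

definition block :: "('a, 'b) pre_digraph \<Rightarrow> ('a, 'b) pre_digraph \<Rightarrow> bool" where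
  "block G B \<longleftrightarrow>
     pre_digraph.max_subgraph G (\<lambda>B'. graph B' \<and> connected B' \<and> (\<nexists>x. cutvertex B' x)) B"

definition trivial_block :: "('a, 'b) pre_digraph \<Rightarrow> bool" where
  "trivial_block B \<longleftrightarrow> complete_digraph 1 B \<or> complete_digraph 2 B"


subsection \<open>Multigraphs and subdivisions\<close>

text \<open>The ends of a loop form a singleton set.\<close>

record ('a, 'e) multigraph =
  mverts :: "'a set"
  medges :: "'e set"
  mends :: "'e \<Rightarrow> 'a set"

definition multigraph :: "('a, 'e) multigraph \<Rightarrow> bool" where
  "multigraph H \<longleftrightarrow> finite (mverts H) \<and> finite (medges H) \<and>
     (\<forall>e \<in> medges H. \<exists>u \<in> mverts H. \<exists>v \<in> mverts H. mends H e = {u, v})"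

definition internal :: "'a list \<Rightarrow> 'a list" where
  "internal p = butlast (tl p)"

text \<open>
  \<^verbatim>\<open>is_subdivision k H B\<close> says that B is the k-subdivision of H, with the vertices of H being
  vertices of B.  The list \<^verbatim>\<open>P e\<close> is the vertex sequence of the path replacing the edge e,
  or of the cycle, starting and ending in the same vertex, if e is a loop.  As B is a simple
  graph, this is meant for \<open>k \<ge> 3\<close>: for smaller k the subdivision of a multigraph may have
  loops or parallel edges, and the latter would be identified here.
\<close>

definition is_subdivision ::
  "nat \<Rightarrow> ('a, 'e) multigraph \<Rightarrow> ('a, 'b) pre_digraph \<Rightarrow> bool" where
  "is_subdivision k H B \<longleftrightarrow> (\<exists>P :: 'e \<Rightarrow> 'a list.
     (\<forall>e \<in> medges H. length (P e) = k + 1 \<and> {hd (P e), last (P e)} = mends H e \<and>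
        distinct (internal (P e)) \<and> set (internal (P e)) \<inter> mverts H = {}) \<and>
     pairwise (\<lambda>e f. set (internal (P e)) \<inter> set (internal (P f)) = {}) (medges H) \<and>
     verts B = mverts H \<union> (\<Union>e \<in> medges H. set (internal (P e))) \<and>
     arcs_ends B = symcl (\<Union>e \<in> medges H. set (vwalk_arcs (P e))))"


subsection \<open>The two graph classes\<close>

definition class_G3 :: "('a, 'b) pre_digraph set" where
  "class_G3 = {G. graph G \<and> (\<forall>F. induced_subgraph F G \<longrightarrow> nu3 F = tau3 F)}"

text \<open>
  As H is finite and its vertices are vertices of B, it is no restriction that the vertices of H
  have the same type as those of G and that its edges are natural numbers.
\<close>

definition class_H3 :: "('a, 'b) pre_digraph set" where
  "class_H3 = {G. graph G \<and> (\<forall>B. block G B \<and> \<not> trivial_block B \<longrightarrow>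
     (\<exists>H :: ('a, nat) multigraph. multigraph H \<and> is_subdivision 3 H B \<and>
        (\<forall>x \<in> verts B. cutvertex G x \<longrightarrow> x \<in> mverts H)))}"

end

theory Submission
  imports Defs
begin

text \<open>
  Both classes consist of the graphs in which every cycle \<open>x\<^sub>0, x\<^sub>1, \<dots>\<close> has length divisible
  by 3 and the indices of any two vertices of degree at least 3 on it agree modulo 3.

  This holds in \<open>\<G>\<^sub>3\<close>: a cover of the 3-paths of an \<open>n\<close>-cycle has at least \<open>n / 3\<close> vertices,
  while a packing inside at most \<open>n + 2\<close> vertices has at most \<open>(n + 2) / 3\<close> members.  On the
  vertex set of a cycle this forces \<open>3 dvd n\<close>, which in turn excludes chords.  If two vertices of
  the cycle have neighbours outside, adding these neighbours forces the cover to be a residue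
  class modulo 3 that contains both vertices.  Conversely, removing from a cycle the residue class
  that contains its branching vertices leaves isolated edges, and the removed vertices are matched
  by as many disjoint 3-paths of the cycle, so that induction reduces equality of packing and
  covering number to forests, where an end of a longest path is removed.

  In a block, the vertices lying at distance divisible by 3 along some cycle from a branching
  vertex are the vertices of the multigraph whose 3-subdivision is the block.  Conversely, every
  cycle lies in a block \<open>Sub\<^sub>3(H)\<close>, runs through a vertex of \<open>H\<close> at every third step, and a
  vertex of degree at least 3 in G that has degree 2 in its block is a cutvertex.
\<close>


subsection \<open>Cycles as periodic sequences\<close>

text \<open>
  A cycle of length \<open>n\<close> is a sequence indexed by the integers with exact period \<open>n\<close>, so that
  rotations and reversals need no index arithmetic modulo \<open>n\<close>.
\<close>

definition cyc :: "'a rel \<Rightarrow> int \<Rightarrow> (int \<Rightarrow> 'a) \<Rightarrow> bool" where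
  "cyc E n f \<longleftrightarrow> 3 \<le> n \<and> (\<forall>i j. f i = f j \<longleftrightarrow> n dvd i - j) \<and> (\<forall>i. (f i, f (i + 1)) \<in> E)"

text \<open>The vertices of degree at least 3, stated without counting.\<close>

definition branching :: "'a rel \<Rightarrow> 'a \<Rightarrow> bool" where
  "branching E v \<longleftrightarrow> (\<forall>p q. \<exists>a. (v, a) \<in> E \<and> a \<noteq> p \<and> a \<noteq> q)"

definition mod3_cycles :: "'a rel \<Rightarrow> bool" where
  "mod3_cycles E \<longleftrightarrow> (\<forall>n f. cyc E n f \<longrightarrow> 3 dvd n \<and>
     (\<forall>i j. branching E (f i) \<and> branching E (f j) \<longrightarrow> 3 dvd i - j))"

lemma branching_mono: "branching F v \<Longrightarrow> F \<subseteq> E \<Longrightarrow> branching E v"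
  unfolding branching_def by blast

lemma cyc_mono: "cyc F n f \<Longrightarrow> F \<subseteq> E \<Longrightarrow> cyc E n f"
  unfolding cyc_def by blast

lemma mod3_cycles_mono: "mod3_cycles E \<Longrightarrow> F \<subseteq> E \<Longrightarrow> mod3_cycles F"
  unfolding mod3_cycles_def using branching_mono cyc_mono by metis

lemma mod3_cyclesD:
  assumes "mod3_cycles E" "cyc E n f"
  shows "3 dvd n" "branching E (f i) \<Longrightarrow> branching E (f j) \<Longrightarrow> 3 dvd i - j"
  using assms unfolding mod3_cycles_def by blast+

lemma cycD:
  assumes "cyc E n f"
  shows "3 \<le> n" "f i = f j \<longleftrightarrow> n dvd i - j" "(f i, f (i + 1)) \<in> E"
  using assms unfolding cyc_def by blast+

lemma cyc_prev: "cyc E n f \<Longrightarrow> (f (i - 1), f i) \<in> E"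
  using cycD(3)[of E n f "i - 1"] by simp

lemma cyc_shift: "cyc E n f \<Longrightarrow> cyc E n (\<lambda>i. f (i + k))"
  unfolding cyc_def by (simp add: add.commute[of _ k] add.assoc[symmetric])

lemma cyc_reverse:
  assumes "cyc E n f" "sym E"
  shows "cyc E n (\<lambda>i. f (- i))"
proof -
  have "n dvd j - i \<longleftrightarrow> n dvd i - j" for i j by (metis dvd_minus_iff minus_diff_eq)
  moreover have "(f (- i), f (- (i + 1))) \<in> E" for i
    using symD[OF assms(2) cyc_prev[OF assms(1), of "- i"]] by simp
  ultimately show ?thesis using cycD(1)[OF assms(1)] cycD(2)[OF assms(1)] unfolding cyc_def by auto
qed

lemma cyc_close_neq:
  assumes "cyc E n f" "i \<noteq> j" "\<bar>i - j\<bar> < n"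
  shows "f i \<noteq> f j"
  using assms cycD(2)[OF assms(1), of i j] zdvd_imp_le[of n "\<bar>i - j\<bar>"] by auto

lemma cyc_mod: "cyc E n f \<Longrightarrow> f (i mod n) = f i"
  using cycD(2) by (metis dvd_minus_mod minus_diff_eq dvd_minus_iff)

lemma cyc_range:
  assumes "cyc E n f"
  shows "range f = (\<lambda>i. f (i + k)) ` {0..<n}" "inj_on (\<lambda>i. f (i + k)) {0..<n}" "finite (range f)" "card (range f) = nat n"
proof -
  have n: "n \<ge> 3" using cycD(1)[OF assms] .
  have r: "range f = (\<lambda>i. f (i + k)) ` {0..<n}" for k
  proof -
    have "f i \<in> (\<lambda>i. f (i + k)) ` {0..<n}" for i
    proof -
      have "f i = f (((i - k) mod n) + k)"
        using cyc_mod[OF cyc_shift[OF assms, of k], of "i - k"] by simp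
      then show ?thesis using n by (intro image_eqI[where x="(i - k) mod n"]) auto
    qed
    then show ?thesis by auto
  qed
  have inj: "inj_on (\<lambda>i. f (i + k)) {0..<n}" for k
  proof (rule inj_onI, rule ccontr)
    fix x y assume xy: "x \<in> {0..<n}" "y \<in> {0..<n}" "f (x + k) = f (y + k)" "x \<noteq> y"
    then have "\<bar>(x + k) - (y + k)\<bar> < n" by auto
    then show False using cyc_close_neq[OF assms, of "x + k" "y + k"] xy by auto
  qed
  show "range f = (\<lambda>i. f (i + k)) ` {0..<n}" "inj_on (\<lambda>i. f (i + k)) {0..<n}" using r inj by auto
  show "finite (range f)" using r[of 0] by simp
  show "card (range f) = nat n" using r[of 0] card_image[OF inj[of 0]] by simp
qed

text \<open>Extends the values on one period to all integers by reducing the index modulo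
  \<open>n\<close>; only the wrap from \<open>n - 1\<close> to 0 uses the closing edge.\<close>

lemma cycI:
  assumes n: "3 \<le> n" and inj: "inj_on g {0..<n}"
    and step: "\<And>i. 0 \<le> i \<Longrightarrow> i < n - 1 \<Longrightarrow> (g i, g (i + 1)) \<in> E"
    and close: "(g (n - 1), g 0) \<in> E"
  shows "cyc E n (\<lambda>i. g (i mod n))"
  unfolding cyc_def
proof (intro conjI allI)
  show "3 \<le> n" by fact
  fix i j
  have "g (i mod n) = g (j mod n) \<longleftrightarrow> i mod n = j mod n"
    using n by (intro inj_on_eq_iff[OF inj]) auto
  then show "g (i mod n) = g (j mod n) \<longleftrightarrow> n dvd i - j" by (simp add: mod_eq_dvd_iff)
next
  fix i
  have b: "0 \<le> i mod n" "i mod n < n" using n by auto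
  have e: "(i + 1) mod n = (i mod n + 1) mod n" by (simp add: mod_simps)
  show "(g (i mod n), g ((i + 1) mod n)) \<in> E"
  proof (cases "i mod n = n - 1")
    case True
    then show ?thesis using close e by simp
  next
    case False
    then have "(i mod n + 1) mod n = i mod n + 1" using b by (intro mod_pos_pos_trivial) auto
    then show ?thesis using False b step[of "i mod n"] e by simp
  qed
qed

lemma cyc_of_path:
  assumes "distinct xs" "3 \<le> length xs" "successively (\<lambda>u v. (u, v) \<in> E) xs" "(last xs, hd xs) \<in> E"
  obtains f where "cyc E (int (length xs)) f" "\<And>i. i < length xs \<Longrightarrow> f (int i) = xs ! i"
proof
  let ?n = "int (length xs)"
  define g where "g i = xs ! nat i" for i
  show "cyc E ?n (\<lambda>i. g (i mod ?n))"
  proof (rule cycI)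
    show "inj_on g {0..<?n}" using assms(1) by (auto simp: inj_on_def g_def nth_eq_iff_index_eq)
    show "(g i, g (i + 1)) \<in> E" if "0 \<le> i" "i < ?n - 1" for i
    proof -
      have "Suc (nat i) < length xs" using that by linarith
      then show ?thesis using assms(3) that
        by (simp add: g_def successively_conv_nth nat_add_distrib)
    qed
    have ne: "xs \<noteq> []" using assms(2) by auto
    have "nat (?n - 1) = length xs - 1" by linarith
    then show "(g (?n - 1), g 0) \<in> E" using assms(4) ne by (simp add: g_def last_conv_nth hd_conv_nth)
  qed (use assms in simp)
  show "g (int i mod ?n) = xs ! i" if "i < length xs" for i
    using that by (simp add: g_def)
qed

section \<open>Vertex sets meeting every three consecutive vertices of a cycle\<close>

lemma exactly_one_in_three:
  fixes P :: "int \<Rightarrow> bool"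
  assumes "\<And>i. (of_bool (P i) + of_bool (P (i + 1)) + of_bool (P (i + 2)) :: int) = 1"
  obtains r where "\<And>i. P i \<longleftrightarrow> 3 dvd i - r"
proof -
  \<comment> \<open>The windows starting at \<open>i\<close> and at \<open>i + 1\<close> have equal
    sums and share two terms.\<close>
  have 3: "P (i + 3) = P i" for i
    using assms[of i] assms[of "i + 1"]
    by (cases "P i"; cases "P (i + 1)"; cases "P (i + 2)"; cases "P (i + 3)") (simp_all add: add.assoc)
  have nat: "P (i + 3 * int k) = P i" for i k
  proof (induction k)
    case (Suc k)
    then show ?case using 3[of "i + 3 * int k"] by (simp add: algebra_simps)
  qed simp
  have int: "P (i + 3 * k) = P i" for i k
  proof (cases "k \<ge> 0")
    case True
    then show ?thesis using nat[of i "nat k"] by simp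
  next
    case False
    then show ?thesis using nat[of "i + 3 * k" "nat (- k)"] by simp
  qed
  obtain r where r: "P r" using assms[of 0] by (cases "P 0"; cases "P 1"; cases "P 2") auto
  have "P i \<longleftrightarrow> 3 dvd i - r" for i
  proof
    assume "3 dvd i - r"
    then obtain k where "i = r + 3 * k" by (metis dvdE diff_add_cancel add.commute)
    then show "P i" using int[of r k] r by simp
  next
    assume Pi: "P i"
    define q where "q = (i - r) div 3"
    have "(i - r) mod 3 = 0 \<or> (i - r) mod 3 = 1 \<or> (i - r) mod 3 = 2" by presburger
    then have "i = r + 3 * q \<or> i = r + 1 + 3 * q \<or> i = r + 2 + 3 * q"
      unfolding q_def by presburger
    moreover have "\<not> P (r + 1)" "\<not> P (r + 2)" using assms[of r] r
      by (cases "P (r + 1)"; cases "P (r + 2)"; simp)+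
    ultimately have "i = r + 3 * q" using int[of r q] int[of "r+1" q] int[of "r+2" q] Pi by blast
    then show "3 dvd i - r" by simp
  qed
  then show thesis by (rule that)
qed

text \<open>Double counting: summing the indicator of \<open>X\<close> over all \<open>n\<close>
  windows of three consecutive vertices counts each vertex of \<open>X\<close> on the cycle three
  times, and every window contributes at least 1. In the case of equality every window contains
  exactly one vertex of \<open>X\<close>.\<close>

lemma
  assumes c: "cyc E n f" and hit: "\<And>i. {f i, f (i + 1), f (i + 2)} \<inter> X \<noteq> {}"
  shows cyc_cover_card: "n \<le> 3 * int (card (X \<inter> range f))"
    and cyc_cover_tight: "n = 3 * int (card (X \<inter> range f)) \<Longrightarrow> \<exists>r. \<forall>i. f i \<in> X \<longleftrightarrow> 3 dvd i - r"
proof -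
  let ?h = "\<lambda>i. of_bool (f i \<in> X) :: int"
  have s: "(\<Sum>i\<in>{0..<n}. ?h (i + k)) = int (card (X \<inter> range f))" for k
  proof -
    have "X \<inter> range f = (\<lambda>i. f (i + k)) ` {i \<in> {0..<n}. f (i + k) \<in> X}"
      by (subst cyc_range(1)[OF c, of k]) auto
    moreover have "inj_on (\<lambda>i. f (i + k)) {i \<in> {0..<n}. f (i + k) \<in> X}"
      using cyc_range(2)[OF c, of k] by (rule inj_on_subset) auto
    ultimately have "card (X \<inter> range f) = card {i \<in> {0..<n}. f (i + k) \<in> X}"
      by (simp add: card_image)
    then show ?thesis by (simp add: of_bool_def sum.If_cases Int_def)
  qed
  have t: "(\<Sum>i\<in>{0..<n}. ?h i + ?h (i + 1) + ?h (i + 2)) = 3 * int (card (X \<inter> range f))"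
    using s[of 0] s[of 1] s[of 2] by (simp add: sum.distrib)
  have ge: "?h i + ?h (i + 1) + ?h (i + 2) \<ge> 1" for i using hit[of i] by auto
  have n: "(\<Sum>i\<in>{0..<n}. 1) = n" using cycD(1)[OF c] by simp
  show "n \<le> 3 * int (card (X \<inter> range f))" using sum_mono[of "{0..<n}" "\<lambda>_. 1" "\<lambda>i. ?h i + ?h (i + 1) + ?h (i + 2)"] ge t n by simp
  assume eq: "n = 3 * int (card (X \<inter> range f))"
  have "?h i + ?h (i + 1) + ?h (i + 2) = 1" for i
  proof -
    let ?g = "\<lambda>i. ?h i + ?h (i + 1) + ?h (i + 2) - 1"
    have "(\<Sum>i\<in>{0..<n}. ?g i) = 0" using t n eq by (simp add: sum_subtractf)
    moreover have "?g i \<ge> 0" for i using ge[of i] by linarith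
    ultimately have z: "\<forall>i\<in>{0..<n}. ?g i = 0" by (subst (asm) sum_nonneg_eq_0_iff) simp_all
    \<comment> \<open>The sum only controls one period; periodicity of \<open>f\<close> carries the
      equality to every window.\<close>
    have p: "f (i mod n + k) = f (i + k)" for k
      using cyc_mod[OF cyc_shift[OF c, of k], of i] by simp
    have "i mod n \<in> {0..<n}" using cycD(1)[OF c] by auto
    then have "?g (i mod n) = 0" using z by blast
    then show ?thesis using p[of 0] p[of 1] p[of 2] by simp
  qed
  then show "\<exists>r. \<forall>i. f i \<in> X \<longleftrightarrow> 3 dvd i - r" by (rule exactly_one_in_three[of "\<lambda>i. f i \<in> X"]) auto
qed

subsection \<open>Packing and covering 3-paths when all cycles are periodic modulo 3\<close>

text \<open>The counterpart of \<open>three_paths\<close> for an adjacency relation, so that passing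
  to an induced subgraph is intersecting the relation with a square.\<close>

definition paths3 :: "'a rel \<Rightarrow> 'a list set" where
  "paths3 E = {[a, b, c] | a b c. distinct [a, b, c] \<and> (a, b) \<in> E \<and> (b, c) \<in> E}"

definition packing :: "'a rel \<Rightarrow> 'a list set \<Rightarrow> bool" where
  "packing E S \<longleftrightarrow> S \<subseteq> paths3 E \<and> finite S \<and> pairwise (\<lambda>p q. set p \<inter> set q = {}) S"

definition cover :: "'a rel \<Rightarrow> 'a set \<Rightarrow> bool" where
  "cover E X \<longleftrightarrow> finite X \<and> (\<forall>p \<in> paths3 E. set p \<inter> X \<noteq> {})"

text \<open>A certificate for equality of packing and covering number: no packing is larger than a
  cover, so such a pair is optimal on both sides.\<close>

definition konig :: "'a rel \<Rightarrow> bool" where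
  "konig E \<longleftrightarrow> (\<exists>S X. packing E S \<and> cover E X \<and> card X \<le> card S)"

abbreviation minus_verts :: "'a rel \<Rightarrow> 'a set \<Rightarrow> 'a rel" where
  "minus_verts E X \<equiv> E \<inter> (- X) \<times> (- X)"

lemma paths3_minus_verts: "paths3 (minus_verts E X) = {p \<in> paths3 E. set p \<inter> X = {}}"
  unfolding paths3_def by auto

text \<open>The certificate for the rest is extended by \<open>T\<close> on the packing side and by
  \<open>X\<close> on the cover side: \<open>X\<close> hits every 3-path that is lost by the
  deletion, and \<open>T\<close> is disjoint from every 3-path that remains.\<close>

lemma konig_reduction:
  assumes IH: "konig (minus_verts E X)" and T: "packing E T" and X: "finite X" "card X \<le> card T"
    and avoid: "\<And>p q. p \<in> paths3 (minus_verts E X) \<Longrightarrow> q \<in> T \<Longrightarrow> set p \<inter> set q = {}"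
  shows "konig E"
proof -
  let ?E = "minus_verts E X"
  obtain S Y where S: "packing ?E S" and Y: "cover ?E Y" and le: "card Y \<le> card S"
    using IH unfolding konig_def by blast
  have sub: "S \<subseteq> paths3 ?E" using S by (simp add: packing_def)
  have "q \<noteq> []" if "q \<in> T" for q using that T by (auto simp: packing_def paths3_def)
  then have ST: "S \<inter> T = {}" using avoid sub by fastforce
  have "packing E (S \<union> T)"
    unfolding packing_def
  proof (intro conjI)
    show "S \<union> T \<subseteq> paths3 E" using sub T paths3_minus_verts by (auto simp: packing_def)
    show "finite (S \<union> T)" using S T by (auto simp: packing_def)
    show "pairwise (\<lambda>p q. set p \<inter> set q = {}) (S \<union> T)"
      using S T avoid sub unfolding packing_def pairwise_def by blast
  qed
  moreover have "cover E (Y \<union> X)"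
    using Y X(1) unfolding cover_def paths3_minus_verts by blast
  moreover have "card (Y \<union> X) \<le> card (S \<union> T)"
    using card_Un_le[of Y X] le X ST S T by (simp add: packing_def card_Un_disjoint)
  ultimately show ?thesis unfolding konig_def by blast
qed

text \<open>The middle vertex of a 3-path has two neighbours, so it is outside \<open>Z\<close>; an
  end in \<open>Z\<close> would force the middle vertex into \<open>Z\<close>.\<close>

lemma paths3_avoid_matching:
  assumes "sym E" "p \<in> paths3 E"
    and step: "\<And>x y. x \<in> Z \<Longrightarrow> (x, y) \<in> E \<Longrightarrow> y \<in> Z"
    and uniq: "\<And>x y z. x \<in> Z \<Longrightarrow> (x, y) \<in> E \<Longrightarrow> (x, z) \<in> E \<Longrightarrow> y = z"
  shows "set p \<inter> Z = {}"
proof -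
  obtain a b c where p: "p = [a, b, c]" "a \<noteq> c" "(a, b) \<in> E" "(b, c) \<in> E"
    using assms(2) unfolding paths3_def by auto
  have "(b, a) \<in> E" "(c, b) \<in> E" using p assms(1) by (auto dest: symD)
  then have "b \<notin> Z" "a \<notin> Z" "c \<notin> Z" using p step uniq by blast+
  then show ?thesis using p by auto
qed

text \<open>Applied with \<open>Z\<close> inducing isolated vertices and edges once X is removed.\<close>

lemma konig_reduction_matching:
  assumes "sym E" "konig (minus_verts E X)" "packing E T" "finite X" "card X \<le> card T"
    and T: "\<And>p. p \<in> T \<Longrightarrow> set p \<subseteq> Z"
    and "\<And>x y. x \<in> Z \<Longrightarrow> (x, y) \<in> minus_verts E X \<Longrightarrow> y \<in> Z"
    and "\<And>x y z. x \<in> Z \<Longrightarrow> (x, y) \<in> minus_verts E X \<Longrightarrow> (x, z) \<in> minus_verts E X \<Longrightarrow> y = z"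
  shows "konig E"
proof (rule konig_reduction[OF assms(2-5)])
  fix p q assume p: "p \<in> paths3 (minus_verts E X)" and "q \<in> T"
  have "sym (minus_verts E X)" using assms(1) by (auto simp: sym_def)
  then have "set p \<inter> Z = {}" using p by (rule paths3_avoid_matching) (use assms(7,8) in blast)+
  then show "set p \<inter> set q = {}" using T[OF \<open>q \<in> T\<close>] by blast
qed

text \<open>A non-branching vertex has all its neighbours among two vertices, and its predecessor
  and successor on the cycle are distinct, so they exhaust these.\<close>

lemma cyc_non_branching:
  assumes "cyc E n f" "sym E" "\<not> branching E (f i)" "(f i, y) \<in> E"
  shows "y = f (i - 1) \<or> y = f (i + 1)"
proof -
  obtain p q where pq: "\<And>a. (f i, a) \<in> E \<Longrightarrow> a = p \<or> a = q"
    using assms(3) unfolding branching_def by blast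
  have "(f i, f (i + 1)) \<in> E" "(f i, f (i - 1)) \<in> E"
    using cycD(3)[OF assms(1)] cyc_prev[OF assms(1)] assms(2) by (auto dest: symD)
  moreover have "f (i + 1) \<noteq> f (i - 1)"
    using cycD(1)[OF assms(1)] by (intro cyc_close_neq[OF assms(1)]) auto
  ultimately show ?thesis using pq assms(4) by metis
qed

lemma konig_step_cyc:
  assumes "mod3_cycles E" "sym E" and c: "cyc E n f"
  obtains X where "finite X" "\<exists>i. f i \<in> X" "konig (minus_verts E X) \<Longrightarrow> konig E"
proof -
  have n: "3 dvd n" "n \<ge> 3" using mod3_cyclesD(1)[OF assms(1) c] cycD(1)[OF c] by auto
  \<comment> \<open>\<open>r\<close> is the index of any branching vertex on the cycle, and
    arbitrary if there is none.\<close>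
  obtain r where r: "\<And>i. branching E (f i) \<Longrightarrow> 3 dvd i - r"
  proof (cases "\<exists>i. branching E (f i)")
    case True
    then show ?thesis using that mod3_cyclesD(2)[OF assms(1) c] by blast
  qed (use that in blast)
  define I where "I = {i. (3::int) dvd i - r}"
  define X where "X = f ` I"
  define T where "T = (\<lambda>i. [f i, f (i + 1), f (i + 2)]) ` I"
  have X_iff: "f i \<in> X \<longleftrightarrow> 3 dvd i - r" for i
  proof
    assume "f i \<in> X"
    then obtain j where j: "3 dvd j - r" "f i = f j" unfolding X_def I_def by auto
    then have "3 dvd i - j" using cycD(2)[OF c] n(1) dvd_trans by blast
    then show "3 dvd i - r" using j(1) by presburger
  qed (auto simp: X_def I_def)
  have fX: "finite X" using cyc_range(3)[OF c] unfolding X_def by (rule finite_subset[rotated]) auto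
  \<comment> \<open>Equal vertices have indices congruent modulo \<open>n\<close>, hence modulo 3,
    so they occupy the same position in their triples. Thus two members of \<open>T\<close> are
    equal or disjoint.\<close>
  have same: "f i = f j \<and> f (i + 1) = f (j + 1) \<and> f (i + 2) = f (j + 2)"
    if "f (i + a) = f (j + b)" "i \<in> I" "j \<in> I" "a \<in> {0, 1, 2}" "b \<in> {0, 1, 2}" for i j a b
  proof -
    have d: "n dvd (i + a) - (j + b)" using that(1) cycD(2)[OF c] by blast
    then have "3 dvd (i + a) - (j + b)" using n(1) dvd_trans by blast
    then have "a = b" using that(2-5) unfolding I_def by (auto; presburger)
    then have "n dvd i - j" using d by simp
    then show ?thesis using cycD(2)[OF c] by simp
  qed
  have "T \<subseteq> {p. set p \<subseteq> range f \<and> length p = 3}" unfolding T_def by auto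
  then have fT: "finite T" using finite_lists_length_eq[OF cyc_range(3)[OF c]] finite_subset by blast
  \<comment> \<open>The index set \<open>I\<close> is infinite, so \<open>X\<close> and
    \<open>T\<close> are compared through \<open>hd\<close> instead of being counted.\<close>
  have "X = hd ` T" unfolding X_def T_def by (auto simp: image_image)
  then have card: "card X \<le> card T" using fT card_image_le by blast
  have pack: "packing E T"
    unfolding packing_def
  proof (intro conjI)
    have "[f i, f (i + 1), f (i + 2)] \<in> paths3 E" for i
    proof -
      have "f i \<noteq> f (i + 1)" "f i \<noteq> f (i + 2)" "f (i + 1) \<noteq> f (i + 2)"
        using n(2) by (intro cyc_close_neq[OF c]; simp)+
      then show ?thesis using cycD(3)[OF c, of i] cycD(3)[OF c, of "i + 1"]
        unfolding paths3_def by (simp add: add.assoc)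
    qed
    then show "T \<subseteq> paths3 E" unfolding T_def by blast
    show "finite T" by fact
    show "pairwise (\<lambda>p q. set p \<inter> set q = {}) T"
    proof (rule pairwiseI, rule ccontr)
      fix p q assume pq: "p \<in> T" "q \<in> T" "p \<noteq> q" "set p \<inter> set q \<noteq> {}"
      obtain i j where ij: "i \<in> I" "j \<in> I" "p = [f i, f (i + 1), f (i + 2)]" "q = [f j, f (j + 1), f (j + 2)]"
        using pq(1,2) unfolding T_def by blast
      obtain x where x: "x \<in> set p" "x \<in> set q" using pq(4) by blast
      have "\<exists>a\<in>{0, 1, 2}. x = f (i + a)" "\<exists>b\<in>{0, 1, 2}. x = f (j + b)" using x ij by auto
      then show False using same ij pq(3) by metis
    qed
  qed
  \<comment> \<open>A surviving cycle vertex is non-branching, and exactly one of its two neighbours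
    lies in the deleted residue class; so the survivors form isolated edges.\<close>
  have nb: "y = f (if 3 dvd i - r - 1 then i + 1 else i - 1)" if "(f i, y) \<in> minus_verts E X" for i y
  proof -
    have i: "\<not> 3 dvd i - r" and y: "y \<notin> X" using that X_iff by auto
    then have "\<not> branching E (f i)" using r by blast
    then have "y = f (i - 1) \<or> y = f (i + 1)" using cyc_non_branching[OF c assms(2)] that by blast
    moreover have "3 dvd (i + 1) - r" if "\<not> 3 dvd i - r - 1" using i that by presburger
    moreover have "3 dvd (i - 1) - r" if "3 dvd i - r - 1" using that by presburger
    ultimately show ?thesis using y X_iff[of "i - 1"] X_iff[of "i + 1"] by auto
  qed
  show thesis
  proof (rule that)
    show "finite X" by fact
    show "\<exists>i. f i \<in> X" using X_iff[of r] by auto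
    assume "konig (minus_verts E X)"
    then show "konig E"
    proof (rule konig_reduction_matching[OF assms(2) _ pack fX card])
      show "set p \<subseteq> range f" if "p \<in> T" for p using that by (auto simp: T_def)
    qed (use nb in blast)+
  qed
qed

text \<open>The first vertex \<open>x0\<close> of a longest path is a leaf attached to
  \<open>x1\<close>. If \<open>x1\<close> has a neighbour \<open>y\<close> besides \<open>x0\<close>
  and \<open>x2\<close>, then \<open>y\<close> is a leaf too and deleting \<open>x1\<close> isolates
  both; otherwise deleting \<open>x2\<close> leaves \<open>x0\<close> and \<open>x1\<close> as an
  isolated edge.\<close>

lemma konig_step_acyclic:
  assumes "finite E" "sym E" "irrefl E" and acyc: "\<And>n f. \<not> cyc E n f" and ne: "paths3 E \<noteq> {}"
  obtains X p where "p \<in> paths3 E" "X \<subseteq> set p" "X \<noteq> {}" "konig (minus_verts E X) \<Longrightarrow> konig E"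
proof -
  define path where "path xs \<longleftrightarrow> distinct xs \<and> successively (\<lambda>u v. (u, v) \<in> E) xs" for xs
  have Field: "set xs \<subseteq> Field E" if "path xs" "length xs \<ge> 2" for xs
  proof
    fix x assume "x \<in> set xs"
    then obtain i where i: "i < length xs" "x = xs ! i" by (metis in_set_conv_nth)
    have st: "(xs ! i, xs ! Suc i) \<in> E" if "Suc i < length xs" for i
      using \<open>path xs\<close> that unfolding path_def successively_conv_nth by blast
    show "x \<in> Field E"
    proof (cases i)
      case 0
      then show ?thesis using st[of 0] i \<open>length xs \<ge> 2\<close> by (auto intro: FieldI1)
    next
      case (Suc j)
      then show ?thesis using st[of j] i by (auto intro: FieldI2)
    qed
  qed
  \<comment> \<open>The summand 1 admits one-vertex paths, whose vertex may lie outside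
    \<open>Field E\<close>.\<close>
  have bound: "length xs \<le> card (Field E) + 1" if "path xs" for xs
  proof (cases "length xs \<ge> 2")
    case True
    have "card (set xs) \<le> card (Field E)"
      using Field[OF that True] assms(1) by (intro card_mono) (auto simp: finite_Field)
    then show ?thesis using that by (simp add: path_def distinct_card)
  qed simp
  obtain q where q: "q \<in> paths3 E" using ne by blast
  then have q': "path q" "length q = 3" by (auto simp: paths3_def path_def)
  obtain xs where xs: "path xs" "\<And>ys. path ys \<Longrightarrow> length ys \<le> length xs"
    using ex_has_greatest_nat[of path q length "card (Field E) + 2"] q'(1) bound
    by (metis add_2_eq_Suc' less_Suc_eq_le Suc_eq_plus1)
  have "length xs \<ge> 3" using xs(2)[OF q'(1)] q'(2) by simp
  then obtain x0 x1 x2 ys where xs_eq: "xs = x0 # x1 # x2 # ys"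
    by (metis One_nat_def Suc_le_length_iff numeral_3_eq_3)
  \<comment> \<open>An edge from the first vertex to a later one other than the second would close
    the initial piece of the path into a cycle.\<close>
  have no_chord: "w = hd zs" if nc: "path (v # zs)" "(v, w) \<in> E" "w \<in> set zs" for v zs w
  proof (rule ccontr)
    assume w: "w \<noteq> hd zs"
    obtain as bs where zs: "zs = as @ w # bs" using split_list[OF nc(3)] by blast
    then obtain a as' where as: "as = a # as'" using w by (cases as) auto
    have "v # zs = (v # as @ [w]) @ bs" using zs by simp
    then have "path (v # as @ [w])" using nc(1) unfolding path_def
      by (metis distinct_append successively_append_iff)
    then obtain f where "cyc E (int (length (v # as @ [w]))) f"
      by (rule_tac cyc_of_path[of "v # as @ [w]" E]) (use nc(2) as assms(2) in \<open>auto simp: path_def dest: symD\<close>)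
    then show False using acyc by blast
  qed
  \<comment> \<open>A neighbour off the path would prolong a path of maximal length.\<close>
  have end_nb: "w = v1" if "path (v # v1 # vs)" "length (v # v1 # vs) = length xs" "(v, w) \<in> E" for v v1 vs w
  proof (cases "w \<in> set (v1 # vs)")
    case True
    then show ?thesis using no_chord[OF that(1) that(3)] by simp
  next
    case False
    have "w \<noteq> v" using that(3) assms(3) by (auto simp: irrefl_def)
    then have "path (w # v # v1 # vs)"
      using False that(1,3) assms(2) by (auto simp: path_def successively_Cons dest: symD)
    then show ?thesis using xs(2) that(2) by fastforce
  qed
  have E01: "(x0, x1) \<in> E" "(x1, x2) \<in> E" "(x1, x0) \<in> E" and d: "distinct [x0, x1, x2]"
    using xs(1) xs_eq assms(2) by (auto simp: path_def dest: symD)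
  have nb0: "w = x1" if "(x0, w) \<in> E" for w using end_nb xs(1) xs_eq that by blast
  show thesis
  proof (cases "\<exists>y. (x1, y) \<in> E \<and> y \<noteq> x0 \<and> y \<noteq> x2")
    case True
    then obtain y where y: "(x1, y) \<in> E" "y \<noteq> x0" "y \<noteq> x2" by blast
    have "path (x1 # x2 # ys)" using xs(1) xs_eq by (auto simp: path_def)
    then have "y \<notin> set (x2 # ys)" using no_chord y by fastforce
    moreover have "y \<noteq> x1" using y(1) assms(3) by (auto simp: irrefl_def)
    \<comment> \<open>Exchanging \<open>x0\<close> for \<open>y\<close> gives another longest path,
      so \<open>end_nb\<close> applies to \<open>y\<close> as well.\<close>
    ultimately have "path (y # x1 # x2 # ys)"
      using xs(1) xs_eq y assms(2) by (auto simp: path_def dest: symD)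
    then have nby: "w = x1" if "(y, w) \<in> E" for w using end_nb xs_eq that by fastforce
    have p: "[x0, x1, y] \<in> paths3 E" using E01 d y \<open>y \<noteq> x1\<close> by (auto simp: paths3_def)
    show thesis
    proof (rule that[of "[x0, x1, y]" "{x1}"])
      assume IH: "konig (minus_verts E {x1})"
      show "konig E"
        by (rule konig_reduction_matching[OF assms(2) IH, of "{[x0, x1, y]}" "{x0, x1, y}"])
          (use p nb0 nby in \<open>auto simp: packing_def\<close>)
    qed (use p in auto)
  next
    case False
    have p: "[x0, x1, x2] \<in> paths3 E" using E01 d by (auto simp: paths3_def)
    show thesis
    proof (rule that[of "[x0, x1, x2]" "{x2}"])
      assume IH: "konig (minus_verts E {x2})"
      show "konig E"
        by (rule konig_reduction_matching[OF assms(2) IH, of "{[x0, x1, x2]}" "{x0, x1, x2}"])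
          (use p nb0 False in \<open>auto simp: packing_def\<close>)
    qed (use p in auto)
  qed
qed

text \<open>Induction on the number of arcs: both reduction steps delete a vertex that has a
  neighbour, and periodicity of the cycles passes to subrelations.\<close>

lemma mod3_cycles_imp_konig:
  assumes "finite E" "sym E" "irrefl E" "mod3_cycles E"
  shows "konig E"
  using assms
proof (induction "card E" arbitrary: E rule: less_induct)
  case less
  show ?case
  proof (cases "paths3 E = {}")
    case True
    then show ?thesis unfolding konig_def packing_def cover_def
      by (intro exI[of _ "{}"]) auto
  next
    case False
    have IH: "konig (minus_verts E X)" if "(u, v) \<in> E" "u \<in> X" for X u v
    proof (rule less.hyps)
      show "card (minus_verts E X) < card E"
        using that less.prems(1) by (intro psubset_card_mono) auto
      show "finite (minus_verts E X)" using less.prems(1) by auto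
      show "sym (minus_verts E X)" using less.prems(2) by (auto simp: sym_def)
      show "irrefl (minus_verts E X)" using less.prems(3) by (auto simp: irrefl_def)
      show "mod3_cycles (minus_verts E X)" using less.prems(4) by (rule mod3_cycles_mono) auto
    qed
    show ?thesis
    proof (cases "\<exists>n f. cyc E n f")
      case True
      then obtain n f where c: "cyc E n f" by blast
      then obtain X i where "f i \<in> X" "konig (minus_verts E X) \<Longrightarrow> konig E"
        using konig_step_cyc[OF less.prems(4,2)] by metis
      then show ?thesis using IH cycD(3)[OF c] by blast
    next
      case no: False
      obtain X p where X: "p \<in> paths3 E" "X \<subseteq> set p" "X \<noteq> {}" "konig (minus_verts E X) \<Longrightarrow> konig E"
        using konig_step_acyclic[OF less.prems(1-3) _ False] no by metis
      obtain x where x: "x \<in> X" "x \<in> set p" using X(2,3) by blast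
      obtain a b c where p: "p = [a, b, c]" "(a, b) \<in> E" "(b, c) \<in> E"
        using X(1) by (auto simp: paths3_def)
      have "\<exists>v. (x, v) \<in> E" using x(2) p less.prems(2) by (auto dest: symD)
      then show ?thesis using X(4) IH x(1) by blast
    qed
  qed
qed

subsection \<open>Periodicity modulo 3 is necessary\<close>

lemma card_Union_packing:
  assumes "packing E S"
  shows "card (\<Union>p\<in>S. set p) = 3 * card S"
proof -
  have "card (\<Union>p\<in>S. set p) = (\<Sum>p\<in>S. card (set p))"
    using assms by (intro card_UN_disjoint) (auto simp: packing_def pairwise_def)
  also have "\<dots> = (\<Sum>p\<in>S. 3)"
    using assms by (intro sum.cong refl) (auto simp: packing_def paths3_def)
  finally show ?thesis by simp
qed

lemma packing_card_le:
  assumes "packing (E \<inter> W \<times> W) S" "finite W"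
  shows "3 * card S \<le> card W"
proof -
  have "(\<Union>p\<in>S. set p) \<subseteq> W" using assms(1) unfolding packing_def paths3_def by fastforce
  then show ?thesis using card_Union_packing[OF assms(1)] card_mono[OF assms(2)] by metis
qed

text \<open>Weak duality: disjoint paths select distinct vertices of the cover.\<close>

lemma packing_le_cover:
  assumes "packing E S" "cover E X"
  shows "card S \<le> card X"
proof -
  have "\<forall>p\<in>S. \<exists>x. x \<in> set p \<inter> X" using assms unfolding packing_def cover_def by blast
  then obtain g where g: "\<And>p. p \<in> S \<Longrightarrow> g p \<in> set p \<inter> X" by metis
  have "inj_on g S"
  proof (rule inj_onI, rule ccontr)
    fix p q assume pq: "p \<in> S" "q \<in> S" "g p = g q" "p \<noteq> q"
    then have "set p \<inter> set q = {}" using assms(1) by (auto simp: packing_def pairwise_def)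
    then show False using g[OF pq(1)] g[OF pq(2)] pq(3) by auto
  qed
  then show ?thesis using g assms(2) by (intro card_inj_on_le[of g]) (auto simp: cover_def)
qed

lemma cyc_path3: "cyc E n f \<Longrightarrow> [f i, f (i + 1), f (i + 2)] \<in> paths3 E"
  using cycD(1)[of E n f] cyc_close_neq[of E n f i "i + 1"] cyc_close_neq[of E n f i "i + 2"]
    cyc_close_neq[of E n f "i + 1" "i + 2"] cycD(3)[of E n f i] cycD(3)[of E n f "i + 1"]
  unfolding paths3_def by (simp add: add.assoc)

lemma cyc_restrict: "cyc E n f \<Longrightarrow> range f \<subseteq> W \<Longrightarrow> cyc (E \<inter> W \<times> W) n f"
  unfolding cyc_def by blast

lemma cyc_Field: "cyc E n f \<Longrightarrow> range f \<subseteq> Field E"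
  using cycD(3) by (metis FieldI1 image_subsetI)

text \<open>The class \<open>class_G3\<close> in terms of adjacency. The sets \<open>W\<close> stay
  inside \<open>Field E\<close> because these are sets of vertices when \<open>E\<close> comes from
  a graph.\<close>

locale hereditary_konig =
  fixes E :: "'a rel"
  assumes sym: "sym E" and irrefl: "irrefl E"
    and konig: "\<And>W. finite W \<Longrightarrow> W \<subseteq> Field E \<Longrightarrow> konig (E \<inter> W \<times> W)"
begin

text \<open>Bounds the cover from both sides: from above because a packing within \<open>W\<close>
  has at most a third of \<open>card W\<close> members, from below because all 3-paths along the
  cycle must be hit. If \<open>W\<close> is hardly larger than the cycle, little freedom
  remains.\<close>

lemma cyc_coverE:
  assumes c: "cyc E n f" and W: "finite W" "range f \<subseteq> W" "W \<subseteq> Field E"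
  obtains X where "cover (E \<inter> W \<times> W) X" "3 * card X \<le> card W" "n \<le> 3 * int (card (X \<inter> range f))"
    "\<And>i. {f i, f (i + 1), f (i + 2)} \<inter> X \<noteq> {}"
proof -
  obtain S X where S: "packing (E \<inter> W \<times> W) S" and X: "cover (E \<inter> W \<times> W) X" and le: "card X \<le> card S"
    using konig[OF W(1,3)] unfolding konig_def by blast
  have "[f i, f (i + 1), f (i + 2)] \<in> paths3 (E \<inter> W \<times> W)" for i
    using cyc_path3[OF cyc_restrict[OF c W(2)]] .
  then have hit: "{f i, f (i + 1), f (i + 2)} \<inter> X \<noteq> {}" for i
    using X unfolding cover_def by fastforce
  have "3 * card X \<le> card W" using packing_card_le[OF S W(1)] le by simp
  then show thesis using that X cyc_cover_card[OF c hit] hit by blast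
qed

text \<open>With \<open>W = range f\<close> the two bounds of \<open>cyc_coverE\<close>
  meet.\<close>

lemma cyc_length:
  assumes c: "cyc E n f"
  shows "3 dvd n"
proof -
  obtain X where X: "cover (E \<inter> range f \<times> range f) X" "3 * card X \<le> card (range f)"
      "n \<le> 3 * int (card (X \<inter> range f))"
    using cyc_coverE[OF c cyc_range(3)[OF c] subset_refl cyc_Field[OF c]] by blast
  have "card (X \<inter> range f) \<le> card X" using X(1) by (intro card_mono) (auto simp: cover_def)
  then have "n = 3 * int (card X)" using X(2,3) cyc_range(4)[OF c] cycD(1)[OF c] by linarith
  then show ?thesis by simp
qed

text \<open>The edge closes the segment from \<open>f i\<close> to \<open>f (i + m)\<close> into a
  cycle with \<open>m + 1\<close> vertices.\<close>

lemma cyc_segment: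
  assumes c: "cyc E n f" and m: "2 \<le> m" "m < n" and e: "(f i, f (i + m)) \<in> E"
  shows "3 dvd m + 1"
proof -
  have "cyc E (m + 1) (\<lambda>k. f (k mod (m + 1) + i))"
  proof (rule cycI[of "m + 1" "\<lambda>k. f (k + i)"])
    show "inj_on (\<lambda>k. f (k + i)) {0..<m + 1}"
      using cyc_range(2)[OF c] by (rule inj_on_subset) (use m in auto)
    show "(f (m + 1 - 1 + i), f (0 + i)) \<in> E" using e sym by (auto dest: symD simp: add.commute)
    show "(f (k + i), f (k + 1 + i)) \<in> E" for k
      using cycD(3)[OF c, of "k + i"] by (simp add: ac_simps)
  qed (use m in auto)
  then show ?thesis by (rule cyc_length)
qed

text \<open>A chord splits the cycle into two cycles whose lengths add up to \<open>n + 2\<close>.\<close>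

lemma cyc_chordless:
  assumes c: "cyc E n f" and e: "(f i, f j) \<in> E"
  shows "f j = f (i - 1) \<or> f j = f (i + 1)"
proof (rule ccontr)
  assume no: "\<not> ?thesis"
  define m where "m = (j - i) mod n"
  have n: "n \<ge> 3" using cycD(1)[OF c] .
  have fj: "f j = f (i + m)"
    using cyc_mod[OF cyc_shift[OF c, of i], of "j - i"] by (simp add: m_def add.commute)
  have b: "0 \<le> m" "m < n" using n by (auto simp: m_def)
  have "m \<noteq> 0" using e fj irrefl by (auto simp: irrefl_def)
  moreover have "m \<noteq> 1" using no fj by auto
  moreover have "m \<noteq> n - 1"
  proof
    assume "m = n - 1"
    then have "f (i + m) = f (i - 1)" by (subst cycD(2)[OF c]) simp
    then show False using no fj by simp
  qed
  ultimately have m: "2 \<le> m" "2 \<le> n - m" "n - m < n" using b by auto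
  have "3 dvd m + 1" using cyc_segment[OF c m(1) b(2)] e fj by simp
  moreover have "(f (i + m), f (i + m + (n - m))) \<in> E"
  proof -
    have "f (i + m + (n - m)) = f i" by (subst cycD(2)[OF c]) simp
    then show ?thesis using e fj sym by (auto dest: symD)
  qed
  then have "3 dvd n - m + 1" using cyc_segment[OF c m(2,3)] by blast
  moreover have "3 dvd n" using cyc_length[OF c] .
  ultimately show False by presburger
qed

lemma cyc_branching:
  assumes c: "cyc E n f" and ij: "branching E (f i)" "branching E (f j)"
  shows "3 dvd i - j"
proof -
  \<comment> \<open>A third neighbour on the cycle would be the end of a chord.\<close>
  have "\<exists>a. (f i, a) \<in> E \<and> a \<notin> range f" if br: "branching E (f i)" for i
  proof -
    obtain a where "(f i, a) \<in> E" "a \<noteq> f (i - 1)" "a \<noteq> f (i + 1)"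
      using br unfolding branching_def by blast
    then show ?thesis using cyc_chordless[OF c] by blast
  qed
  from this[OF ij(1)] this[OF ij(2)] obtain a b
    where a: "(f i, a) \<in> E" "a \<notin> range f" and b: "(f j, b) \<in> E" "b \<notin> range f" by blast
  define W where "W = range f \<union> {a, b}"
  have W: "finite W" "range f \<subseteq> W" "W \<subseteq> Field E"
    using cyc_range(3)[OF c] cyc_Field[OF c] a(1) b(1) by (auto simp: W_def intro: FieldI2)
  obtain X where X: "cover (E \<inter> W \<times> W) X" "3 * card X \<le> card W" "n \<le> 3 * int (card (X \<inter> range f))"
    "\<And>i. {f i, f (i + 1), f (i + 2)} \<inter> X \<noteq> {}"
    using cyc_coverE[OF c W] by blast
  have "card W \<le> card (range f) + 2"
    unfolding W_def using card_Un_le[of "range f" "{a, b}"] card_insert_le_m1[of 2 "{b}" a] by simp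
  then have cW: "int (card W) \<le> n + 2" using cyc_range(4)[OF c] cycD(1)[OF c] by simp
  have fX: "finite X" using X(1) by (simp add: cover_def)
  have le: "card (X \<inter> range f) \<le> card X" using fX by (intro card_mono) auto
  have "3 dvd n" using cyc_length[OF c] .
  \<comment> \<open>The bounds \<open>n \<le> 3 * card (X \<inter> range f)\<close> and
    \<open>3 * card X \<le> n + 2\<close> leave no slack because 3 divides \<open>n\<close>; so
    \<open>X\<close> lies on the cycle and is tight.\<close>
  then have eq: "n = 3 * int (card (X \<inter> range f))" "card X \<le> card (X \<inter> range f)"
    using X(2,3) cW le by presburger+
  have "X \<inter> range f = X" using eq(2) fX by (intro card_seteq) auto
  then have sub: "X \<subseteq> range f" by blast
  obtain r where r: "\<And>i. f i \<in> X \<longleftrightarrow> 3 dvd i - r"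
    using cyc_cover_tight[OF c X(4) eq(1)] by blast
  \<comment> \<open>As \<open>w\<close> is not in \<open>X\<close>, a cover avoiding
    \<open>f k\<close> would have to hit the 3-paths \<open>w\<close>, \<open>f k\<close>,
    \<open>f (k + 1)\<close> and \<open>w\<close>, \<open>f k\<close>, \<open>f (k - 1)\<close> at
    their far ends, but these are in different residue classes.\<close>
  have "f k \<in> X" if "(f k, w) \<in> E" "w \<in> W" "w \<notin> range f" for k w
  proof (rule ccontr)
    assume k: "f k \<notin> X"
    have "f l \<in> X" if "(f k, f l) \<in> E" for l
    proof -
      have "[w, f k, f l] \<in> paths3 (E \<inter> W \<times> W)"
        using that \<open>(f k, w) \<in> E\<close> \<open>w \<in> W\<close> \<open>w \<notin> range f\<close> W(2) sym irrefl
        by (auto simp: paths3_def irrefl_def dest: symD)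
      then have "{w, f k, f l} \<inter> X \<noteq> {}" using X(1) unfolding cover_def by fastforce
      then show ?thesis using k sub \<open>w \<notin> range f\<close> by blast
    qed
    then have "f (k + 1) \<in> X" "f (k - 1) \<in> X"
      using cycD(3)[OF c] cyc_prev[OF c] sym by (auto dest: symD)
    then show False using r[of "k + 1"] r[of "k - 1"] by presburger
  qed
  then have "f i \<in> X" "f j \<in> X" using a b by (auto simp: W_def)
  then show ?thesis using r[of i] r[of j] by presburger
qed

lemma mod3_cycles: "mod3_cycles E"
  unfolding mod3_cycles_def using cyc_length cyc_branching by blast

end

subsection \<open>Graphs, cutvertices and nonseparablearable sets\<close>

lemma three_paths_conv:
  assumes "wf_digraph F"
  shows "three_paths F = paths3 (arcs_ends F)"
proof -
  interpret wf_digraph F by fact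
  have "p \<in> three_paths F \<longleftrightarrow> p \<in> paths3 (arcs_ends F)" for p
  proof
    assume "p \<in> three_paths F"
    then have p: "vpath p F" "length p = 3" by (auto simp: three_paths_def)
    then obtain a b c where "p = [a, b, c]" by (auto simp: length_Suc_conv numeral_3_eq_3)
    then show "p \<in> paths3 (arcs_ends F)" using p(1) by (auto simp: paths3_def vpath_def vwalk_def)
  next
    assume "p \<in> paths3 (arcs_ends F)"
    then show "p \<in> three_paths F"
      by (auto simp: paths3_def three_paths_def vpath_def vwalk_def dest: adj_in_verts)
  qed
  then show ?thesis by blast
qed

text \<open>An optimal packing and an optimal cover form the certificate; conversely a certificate
  yields the inequality that complements weak duality.\<close>

lemma nu3_eq_tau3_iff:
  assumes "graph F"
  shows "nu3 F = tau3 F \<longleftrightarrow> konig (arcs_ends F)"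
proof -
  interpret graph F by fact
  let ?E = "arcs_ends F"
  have tp: "three_paths F = paths3 ?E" using three_paths_conv wf_digraph by blast
  have sub: "set p \<subseteq> verts F" if "p \<in> paths3 ?E" for p
    using that unfolding paths3_def by (auto dest: adj_in_verts)
  have "paths3 ?E \<subseteq> {p. set p \<subseteq> verts F \<and> length p = 3}" using sub by (auto simp: paths3_def)
  then have fin: "finite (paths3 ?E)"
    using finite_lists_length_eq[OF finite_verts] finite_subset by blast
  define N where "N = {card S | S. S \<subseteq> three_paths F \<and> pairwise (\<lambda>p q. set p \<inter> set q = {}) S}"
  define T where "T = {card X | X. X \<subseteq> verts F \<and> (\<forall>p \<in> three_paths F. set p \<inter> X \<noteq> {})}"
  have N: "N = card ` {S. packing ?E S}"
    unfolding N_def tp packing_def using finite_subset[OF _ fin] by blast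
  have T: "T = card ` {X. X \<subseteq> verts F \<and> cover ?E X}"
    unfolding T_def tp cover_def using finite_subset[OF _ finite_verts] by blast
  have "{S. packing ?E S} \<subseteq> Pow (paths3 ?E)" by (auto simp: packing_def)
  then have "finite {S. packing ?E S}" using fin finite_subset by blast
  then have fN: "finite N" unfolding N by simp
  have "finite {X. X \<subseteq> verts F \<and> cover ?E X}" by simp
  then have fT: "finite T" unfolding T by simp
  have "packing ?E {}" by (simp add: packing_def)
  then have nN: "N \<noteq> {}" unfolding N by blast
  have "cover ?E (verts F)"
    using sub by (fastforce simp: cover_def paths3_def)
  then have nT: "T \<noteq> {}" unfolding T by blast
  have nu: "nu3 F = Max N" and tau: "tau3 F = Min T" by (simp_all add: nu3_def tau3_def N_def T_def)
  show ?thesis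
  proof
    assume eq: "nu3 F = tau3 F"
    obtain S where "packing ?E S" "card S = Max N" using Max_in[OF fN nN] unfolding N by auto
    moreover obtain X where "cover ?E X" "card X = Min T" using Min_in[OF fT nT] unfolding T by auto
    ultimately show "konig ?E" using eq nu tau unfolding konig_def by force
  next
    assume "konig ?E"
    then obtain S X where S: "packing ?E S" and X: "cover ?E X" and le: "card X \<le> card S"
      unfolding konig_def by blast
    \<comment> \<open>\<open>cover\<close> admits points outside the graph, whereas
      \<open>tau3\<close> ranges over subsets of \<open>verts F\<close>.\<close>
    have "cover ?E (X \<inter> verts F)" using X sub unfolding cover_def by blast
    then have "Min T \<le> card (X \<inter> verts F)" unfolding T using fT T by (intro Min_le) auto
    also have "\<dots> \<le> card X" using X by (intro card_mono) (auto simp: cover_def)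
    also have "\<dots> \<le> card S" by fact
    also have "\<dots> \<le> Max N" using fN S N by (intro Max_ge) auto
    finally have "Min T \<le> Max N" .
    moreover have "Max N \<le> Min T"
      using Max_in[OF fN nN] Min_in[OF fT nT] packing_le_cover unfolding N T by fastforce
    ultimately show "nu3 F = tau3 F" using nu tau by simp
  qed
qed

section \<open>Induced subgraphs and the characterisation of \<open>class_G3\<close> by
  cycles\<close>

lemma arcs_ends_induce: "arcs_ends (G \<restriction> W) = arcs_ends G \<inter> W \<times> W"
  by (auto simp: arcs_ends_conv)

lemma graph_induced:
  assumes "graph G" "induced_subgraph F G"
  shows "graph F"
proof -
  interpret graph G by fact
  show ?thesis using digraphI_induced[OF assms(2)] induced_graph_imp_symmetric[OF sym_arcs assms(2)]
    by (rule digraph.graphI)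
qed

lemma graph_arcs_ends:
  assumes "graph G"
  shows "sym (arcs_ends G)" "irrefl (arcs_ends G)" "finite (arcs_ends G)" "finite (verts G)"
    "arcs_ends G \<subseteq> verts G \<times> verts G" "Field (arcs_ends G) \<subseteq> verts G"
proof -
  interpret graph G by fact
  show "sym (arcs_ends G)" using sym_arcs by (simp add: symmetric_def)
  show "irrefl (arcs_ends G)" using adj_not_same by (auto simp: irrefl_def)
  show "finite (arcs_ends G)" by (simp add: arcs_ends_def)
  show "finite (verts G)" by simp
  show "arcs_ends G \<subseteq> verts G \<times> verts G" by (auto dest: adj_in_verts)
  then show "Field (arcs_ends G) \<subseteq> verts G" by (auto simp: Field_def)
qed

lemma class_G3_iff: "G \<in> class_G3 \<longleftrightarrow> graph G \<and> mod3_cycles (arcs_ends G)"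
proof -
  have "(\<forall>F. induced_subgraph F G \<longrightarrow> nu3 F = tau3 F) \<longleftrightarrow> mod3_cycles (arcs_ends G)" if G: "graph G"
  proof -
    interpret graph G by fact
    note E = graph_arcs_ends[OF G]
    show ?thesis
    proof
      assume H: "\<forall>F. induced_subgraph F G \<longrightarrow> nu3 F = tau3 F"
      have "konig (arcs_ends G \<inter> W \<times> W)" if "W \<subseteq> Field (arcs_ends G)" for W
      proof -
        have "induced_subgraph (G \<restriction> W) G" using that E(6) by (intro induced_induce) blast
        then show ?thesis using H nu3_eq_tau3_iff[OF graph_induced[OF G]] by (metis arcs_ends_induce)
      qed
      then interpret hereditary_konig "arcs_ends G" using E by unfold_locales
      show "mod3_cycles (arcs_ends G)" by (rule mod3_cycles)
    next
      assume g: "mod3_cycles (arcs_ends G)"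
      show "\<forall>F. induced_subgraph F G \<longrightarrow> nu3 F = tau3 F"
      proof (intro allI impI)
        fix F assume F: "induced_subgraph F G"
        have "mod3_cycles (arcs_ends F)"
          using g arcs_ends_mono[OF induced_imp_subgraph[OF F]] by (rule mod3_cycles_mono)
        then show "nu3 F = tau3 F"
          using mod3_cycles_imp_konig graph_arcs_ends[OF graph_induced[OF G F]]
            nu3_eq_tau3_iff[OF graph_induced[OF G F]] by blast
      qed
    qed
  qed
  then show ?thesis unfolding class_G3_def by blast
qed

section \<open>Connected and nonseparable vertex sets of a relation\<close>

definition conn_on :: "'a rel \<Rightarrow> 'a set \<Rightarrow> bool" where
  "conn_on E W \<longleftrightarrow> (\<forall>u \<in> W. \<forall>v \<in> W. (u, v) \<in> (E \<inter> W \<times> W)\<^sup>*)"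

text \<open>The vertex sets inducing connected subgraphs without cutvertices. Nonemptiness is
  explicit because \<open>conn_on\<close> holds for the empty set.\<close>

definition nonseparable :: "'a rel \<Rightarrow> 'a set \<Rightarrow> bool" where
  "nonseparable E W \<longleftrightarrow> W \<noteq> {} \<and> conn_on E W \<and> (\<forall>x. conn_on E (W - {x}))"

lemma conn_on_mono: "conn_on F W \<Longrightarrow> F \<subseteq> E \<Longrightarrow> conn_on E W"
  unfolding conn_on_def by (meson Int_mono order_refl rtrancl_mono subsetD)

lemma nonseparable_mono: "nonseparable F W \<Longrightarrow> F \<subseteq> E \<Longrightarrow> nonseparable E W"
  unfolding nonseparable_def using conn_on_mono by blast

lemma conn_on_Un:
  assumes "conn_on E A" "conn_on E B" "z \<in> A" "z \<in> B"
  shows "conn_on E (A \<union> B)"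
proof -
  let ?R = "(E \<inter> (A \<union> B) \<times> (A \<union> B))\<^sup>*"
  have "(E \<inter> A \<times> A)\<^sup>* \<subseteq> ?R" "(E \<inter> B \<times> B)\<^sup>* \<subseteq> ?R" by (intro rtrancl_mono; blast)+
  then have "(u, z) \<in> ?R" "(z, u) \<in> ?R" if "u \<in> A \<union> B" for u
    using that assms unfolding conn_on_def by blast+
  then show ?thesis unfolding conn_on_def by (meson rtrancl_trans)
qed

text \<open>Of two common vertices at least one survives the deletion of \<open>x\<close> and keeps
  the two parts joined.\<close>

lemma nonseparable_Un:
  assumes "nonseparable E A" "nonseparable E B" "y \<in> A \<inter> B" "z \<in> A \<inter> B" "y \<noteq> z"
  shows "nonseparable E (A \<union> B)"
  unfolding nonseparable_def
proof (intro conjI allI)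
  show "A \<union> B \<noteq> {}" using assms by blast
  show "conn_on E (A \<union> B)" using assms conn_on_Un unfolding nonseparable_def by (metis Int_iff)
  fix x
  have "conn_on E ((A - {x}) \<union> (B - {x}))"
  proof (cases "x = y")
    case True
    then show ?thesis using assms conn_on_Un[of E "A - {x}" "B - {x}" z] unfolding nonseparable_def by blast
  next
    case False
    then show ?thesis using assms conn_on_Un[of E "A - {x}" "B - {x}" y] unfolding nonseparable_def by blast
  qed
  then show "conn_on E (A \<union> B - {x})" by (simp add: Un_Diff)
qed

lemma nonseparable_restrict: "nonseparable (E \<inter> W \<times> W) W \<longleftrightarrow> nonseparable E W"
proof -
  have "conn_on (E \<inter> W \<times> W) A \<longleftrightarrow> conn_on E A" if "A \<subseteq> W" for A
  proof -
    have "E \<inter> W \<times> W \<inter> A \<times> A = E \<inter> A \<times> A" using that by blast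
    then show ?thesis by (simp add: conn_on_def)
  qed
  then show ?thesis by (auto simp: nonseparable_def)
qed

text \<open>Every component after deleting \<open>x\<close> lies in a component of \<open>E\<close>,
  which defines the map \<open>h\<close> on components. If no pair is separated, \<open>h\<close> is
  injective and the number cannot grow; if some pair is separated, \<open>h\<close> is onto the
  components of \<open>E\<close> but not injective.\<close>

lemma card_components_less_iff:
  assumes "sym E" "finite V" "x \<in> V" "E \<subseteq> V \<times> V"
  defines "cls R \<equiv> \<lambda>u. {v. (u, v) \<in> R\<^sup>*}" and "F \<equiv> minus_verts E {x}"
  shows "card (cls E ` V) < card (cls F ` (V - {x})) \<longleftrightarrow>
    (\<exists>u v. u \<in> V - {x} \<and> v \<in> V - {x} \<and> (u, v) \<in> E\<^sup>* \<and> (u, v) \<notin> F\<^sup>*)"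
    (is "_ \<longleftrightarrow> ?sep")
proof -
  have "sym F" using assms(1) by (auto simp: F_def sym_def)
  have eq: "cls R u = cls R v \<longleftrightarrow> (u, v) \<in> R\<^sup>*" if "sym R" for R u v
  proof
    assume "cls R u = cls R v"
    then have "v \<in> cls R u" by (auto simp: cls_def)
    then show "(u, v) \<in> R\<^sup>*" by (simp add: cls_def)
  next
    assume "(u, v) \<in> R\<^sup>*"
    moreover then have "(v, u) \<in> R\<^sup>*" using sym_rtrancl[OF that] by (auto dest: symD)
    ultimately show "cls R u = cls R v" by (auto simp: cls_def intro: rtrancl_trans)
  qed
  have FE: "F\<^sup>* \<subseteq> E\<^sup>*" by (intro rtrancl_mono) (auto simp: F_def)
  define h where "h S = (\<Union>u\<in>S. cls E u)" for S
  have h: "h (cls F u) = cls E u" for u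
  proof -
    have "cls E v = cls E u" if "v \<in> cls F u" for v
    proof -
      have "(u, v) \<in> E\<^sup>*" using that FE by (auto simp: cls_def)
      then show ?thesis using eq[OF assms(1)] by metis
    qed
    moreover have "u \<in> cls F u" by (simp add: cls_def)
    ultimately show ?thesis unfolding h_def by blast
  qed
  have fin: "finite (cls F ` (V - {x}))" using assms(2) by simp
  have img: "h ` cls F ` (V - {x}) = cls E ` (V - {x})" by (simp add: image_image h)
  show ?thesis
  proof
    assume less: "card (cls E ` V) < card (cls F ` (V - {x}))"
    show ?sep
    proof (rule ccontr)
      assume no: "\<not> ?sep"
      have "inj_on h (cls F ` (V - {x}))"
      proof (rule inj_onI)
        fix S T assume "S \<in> cls F ` (V - {x})" "T \<in> cls F ` (V - {x})" "h S = h T"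
        then obtain u v where uv: "u \<in> V - {x}" "v \<in> V - {x}" "S = cls F u" "T = cls F v" by blast
        then have "cls E u = cls E v" using \<open>h S = h T\<close> h by simp
        then have "(u, v) \<in> F\<^sup>*" using no uv eq[OF assms(1)] by blast
        then show "S = T" using uv(3,4) eq[OF \<open>sym F\<close>] by simp
      qed
      then have "card (cls F ` (V - {x})) = card (cls E ` (V - {x}))" using img card_image by metis
      also have "\<dots> \<le> card (cls E ` V)" using assms(2) by (intro card_mono) auto
      finally show False using less by simp
    qed
  next
    assume ?sep
    then obtain u v where uv: "u \<in> V - {x}" "v \<in> V - {x}" "(u, v) \<in> E\<^sup>*" "(u, v) \<notin> F\<^sup>*" by blast
    \<comment> \<open>Without another neighbour, \<open>x\<close> could not help to connect
      \<open>u\<close> with \<open>v\<close>. The vertex \<open>y\<close> still represents the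
      component of \<open>x\<close> after the deletion, so \<open>h\<close> misses no
      component.\<close>
    have "\<exists>y. (x, y) \<in> E \<and> y \<noteq> x"
    proof (rule ccontr)
      assume no: "\<nexists>y. (x, y) \<in> E \<and> y \<noteq> x"
      then have "E \<subseteq> F \<union> {(x, x)}" using assms(1) by (auto simp: F_def dest: symD)
      then have "E\<^sup>* \<subseteq> (F \<union> Id)\<^sup>*" by (intro rtrancl_mono) auto
      then show False using uv by (auto simp: rtrancl_r_diff_Id)
    qed
    then obtain y where y: "(x, y) \<in> E" "y \<in> V - {x}" using assms(4) by blast
    then have "cls E x = cls E y" using eq[OF assms(1)] by blast
    then have "cls E ` V = cls E ` (V - {x})" using y(2) assms(3) by auto
    then have img': "h ` cls F ` (V - {x}) = cls E ` V" using img by simp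
    have "\<not> inj_on h (cls F ` (V - {x}))"
    proof
      assume "inj_on h (cls F ` (V - {x}))"
      moreover have "h (cls F u) = h (cls F v)" using h uv(3) eq[OF assms(1)] by simp
      ultimately have "cls F u = cls F v" using uv by (auto dest: inj_onD)
      then show False using uv(4) eq[OF \<open>sym F\<close>] by simp
    qed
    then show "card (cls E ` V) < card (cls F ` (V - {x}))"
      using img' card_image_le[OF fin, of h] eq_card_imp_inj_on[OF fin, of h] by force
  qed
qed

section \<open>Cutvertices and nonseparability of graphs in terms of reachability\<close>

lemma card_sccs:
  assumes "graph G"
  shows "card (pre_digraph.sccs G) = card ((\<lambda>u. {v. (u, v) \<in> (arcs_ends G)\<^sup>*}) ` verts G)"
proof -
  interpret graph G by fact
  have "scc_of u = {v. (u, v) \<in> (arcs_ends G)\<^sup>*}" if "u \<in> verts G" for u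
    using that by (auto simp: scc_of_def reachable_conv'[symmetric] intro: symmetric_reachable')
  then show ?thesis by (simp add: card_sccs_verts[symmetric] sccs_verts_conv_scc_of)
qed

lemma cutvertex_iff:
  assumes "graph G"
  shows "cutvertex G x \<longleftrightarrow> x \<in> verts G \<and> (\<exists>u v. u \<in> verts G - {x} \<and> v \<in> verts G - {x} \<and>
    (u, v) \<in> (arcs_ends G)\<^sup>* \<and> (u, v) \<notin> (minus_verts (arcs_ends G) {x})\<^sup>*)"
proof -
  interpret graph G by fact
  have E: "arcs_ends G \<subseteq> verts G \<times> verts G" "sym (arcs_ends G)" using graph_arcs_ends[OF assms] by auto
  have D: "del_vert x = G \<restriction> (verts G - {x})"
    by (auto simp: del_vert_def induce_subgraph_def)
  have "graph (del_vert x)" unfolding D using assms by (rule graph_induced) auto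
  moreover have "arcs_ends (del_vert x) = minus_verts (arcs_ends G) {x}"
    unfolding D arcs_ends_induce using E by blast
  moreover have "verts (del_vert x) = verts G - {x}" by (simp add: D)
  ultimately show ?thesis
    unfolding cutvertex_def
    using card_components_less_iff[OF E(2) finite_verts _ E(1)] card_sccs[OF assms] card_sccs by metis
qed

lemma nonseparable_iff:
  assumes "graph F"
  shows "connected F \<and> (\<nexists>x. cutvertex F x) \<longleftrightarrow> nonseparable (arcs_ends F) (verts F)"
proof -
  interpret graph F by fact
  let ?E = "arcs_ends F" and ?V = "verts F"
  have E: "?E \<subseteq> ?V \<times> ?V" using graph_arcs_ends[OF assms] by auto
  then have EV: "?E \<inter> ?V \<times> ?V = ?E" "?E \<inter> (?V - {x}) \<times> (?V - {x}) = minus_verts ?E {x}" for x by blast+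
  have con: "connected F \<longleftrightarrow> ?V \<noteq> {} \<and> conn_on ?E ?V"
  proof
    assume "connected F"
    then have "strongly_connected F" using symmetric_connected_imp_strongly_connected sym_arcs by blast
    then show "?V \<noteq> {} \<and> conn_on ?E ?V"
      unfolding strongly_connected_def conn_on_def EV by (auto simp: reachable_conv')
  next
    assume "?V \<noteq> {} \<and> conn_on ?E ?V"
    then show "connected F"
      unfolding conn_on_def EV
      by (intro connectedI) (auto simp: reachable_mk_symmetric_eq[OF sym_arcs] reachable_conv')
  qed
  show ?thesis
  proof
    assume L: "connected F \<and> (\<nexists>x. cutvertex F x)"
    have "conn_on ?E (?V - {x})" for x
    proof (cases "x \<in> ?V")
      case True
      have "(u, v) \<in> ?E\<^sup>*" if "u \<in> ?V" "v \<in> ?V" for u v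
        using that con L unfolding conn_on_def EV by blast
      then show ?thesis
        using True L cutvertex_iff[OF assms] unfolding conn_on_def EV by blast
    qed (use con L in simp)
    then show "nonseparable ?E ?V" using con L unfolding nonseparable_def by blast
  next
    assume N: "nonseparable ?E ?V"
    then have "\<not> cutvertex F x" for x
      unfolding cutvertex_iff[OF assms] nonseparable_def conn_on_def EV by blast
    then show "connected F \<and> (\<nexists>x. cutvertex F x)" using con N unfolding nonseparable_def by blast
  qed
qed

subsection \<open>3-subdivisions as graphs with a spaced vertex set\<close>

text \<open>A description of 3-subdivisions without the multigraph: the vertices outside
  \<open>M\<close> are paired by adjacency, and each pair with its neighbours in \<open>M\<close> is
  the path, or the cycle if these neighbours coincide, that replaces one edge.\<close>

definition spaced :: "'a rel \<Rightarrow> 'a set \<Rightarrow> 'a set \<Rightarrow> bool" where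
  "spaced E V M \<longleftrightarrow> M \<subseteq> V \<and> E \<inter> M \<times> M = {} \<and>
     (\<forall>v \<in> V - M. (\<exists>!u. u \<in> M \<and> (v, u) \<in> E) \<and> (\<exists>!w. w \<notin> M \<and> (v, w) \<in> E))"

text \<open>Each edge is replaced by vertices \<open>s\<close>, \<open>a\<close>, \<open>b\<close>,
  \<open>t\<close> with \<open>s\<close> and \<open>t\<close> in \<open>H\<close>. Disjointness of
  the interiors leaves \<open>a\<close> with the neighbours \<open>s\<close> and \<open>b\<close>
  only, and \<open>b\<close> with \<open>t\<close> and \<open>a\<close> only.\<close>

lemma subdivision_imp_spaced:
  assumes "multigraph H" "is_subdivision 3 H B"
  shows "spaced (arcs_ends B) (verts B) (mverts H)"
proof -
  obtain P where P: "\<forall>e \<in> medges H. length (P e) = 3 + 1 \<and> {hd (P e), last (P e)} = mends H e \<and>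
        distinct (internal (P e)) \<and> set (internal (P e)) \<inter> mverts H = {}"
     and disj: "pairwise (\<lambda>e f. set (internal (P e)) \<inter> set (internal (P f)) = {}) (medges H)"
     and V: "verts B = mverts H \<union> (\<Union>e \<in> medges H. set (internal (P e)))"
     and E: "arcs_ends B = symcl (\<Union>e \<in> medges H. set (vwalk_arcs (P e)))"
    using assms(2) unfolding is_subdivision_def by blast
  define s a b t where "s e = P e ! 0" and "a e = P e ! 1" and "b e = P e ! 2" and "t e = P e ! 3" for e
  have P_eq: "P e = [s e, a e, b e, t e]" if "e \<in> medges H" for e
  proof -
    have "length (P e) = 4" using P that by simp
    then obtain w x y z where "P e = [w, x, y, z]"
      by (auto simp: length_Suc_conv eval_nat_numeral)
    then show ?thesis by (simp add: s_def a_def b_def t_def)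
  qed
  have e: "s e \<in> mverts H" "t e \<in> mverts H" "a e \<noteq> b e" "a e \<notin> mverts H" "b e \<notin> mverts H"
    if "e \<in> medges H" for e
  proof -
    have "{s e, t e} = mends H e" using P P_eq[OF that] that by fastforce
    moreover have "mends H e \<subseteq> mverts H" using assms(1) that unfolding multigraph_def by fastforce
    ultimately show "s e \<in> mverts H" "t e \<in> mverts H" by auto
    show "a e \<noteq> b e" "a e \<notin> mverts H" "b e \<notin> mverts H"
      using P P_eq[OF that] that unfolding internal_def by force+
  qed
  have ab: "{a e, b e} \<inter> {a f, b f} = {}" if "e \<in> medges H" "f \<in> medges H" "e \<noteq> f" for e f
    using disj that P_eq unfolding pairwise_def internal_def by fastforce
  have V': "verts B = mverts H \<union> (\<Union>e \<in> medges H. {a e, b e})"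
    unfolding V using P_eq by (auto simp: internal_def)
  have "(\<Union>e \<in> medges H. set (vwalk_arcs (P e))) = (\<Union>e \<in> medges H. {(s e, a e), (a e, b e), (b e, t e)})"
    using P_eq by (intro SUP_cong refl) simp
  then have E': "(x, y) \<in> arcs_ends B \<longleftrightarrow> (\<exists>e \<in> medges H. (x, y) \<in> {(s e, a e), (a e, b e), (b e, t e)} \<or>
      (y, x) \<in> {(s e, a e), (a e, b e), (b e, t e)})" for x y
    unfolding E symcl_def by (auto simp: image_iff)
  have na: "(a e, w) \<in> arcs_ends B \<longleftrightarrow> w = s e \<or> w = b e" if "e \<in> medges H" for e w
  proof
    assume "(a e, w) \<in> arcs_ends B"
    then obtain f where f: "f \<in> medges H" "(a e, w) \<in> {(s f, a f), (a f, b f), (b f, t f)} \<or>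
      (w, a e) \<in> {(s f, a f), (a f, b f), (b f, t f)}" unfolding E' by blast
    then have "a e \<in> {a f, b f}" using e[OF that] e[OF f(1)] by auto
    then have "f = e" using ab[OF that f(1)] by blast
    then show "w = s e \<or> w = b e" using f(2) e[OF that] by auto
  qed (use E' that in auto)
  have nb: "(b e, w) \<in> arcs_ends B \<longleftrightarrow> w = t e \<or> w = a e" if "e \<in> medges H" for e w
  proof
    assume "(b e, w) \<in> arcs_ends B"
    then obtain f where f: "f \<in> medges H" "(b e, w) \<in> {(s f, a f), (a f, b f), (b f, t f)} \<or>
      (w, b e) \<in> {(s f, a f), (a f, b f), (b f, t f)}" unfolding E' by blast
    then have "b e \<in> {a f, b f}" using e[OF that] e[OF f(1)] by auto
    then have "f = e" using ab[OF that f(1)] by blast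
    then show "w = t e \<or> w = a e" using f(2) e[OF that] by auto
  qed (use E' that in auto)
  show ?thesis
    unfolding spaced_def
  proof (intro conjI ballI)
    show "mverts H \<subseteq> verts B" using V by blast
    show "arcs_ends B \<inter> mverts H \<times> mverts H = {}" using E' e by auto
    fix v assume "v \<in> verts B - mverts H"
    then obtain f where "f \<in> medges H" "v = a f \<or> v = b f" using V' by blast
    then show "\<exists>!u. u \<in> mverts H \<and> (v, u) \<in> arcs_ends B" "\<exists>!w. w \<notin> mverts H \<and> (v, w) \<in> arcs_ends B"
      using na nb e by metis+
  qed
qed

text \<open>Sending a vertex outside \<open>M\<close> to its neighbour outside \<open>M\<close> is a
  fixed-point-free involution \<open>q\<close>. Its orbits serve as the edges of \<open>H\<close>,
  with the \<open>M\<close>-neighbours of the two members as ends.\<close>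

lemma spaced_imp_subdivision:
  assumes "graph B" "spaced (arcs_ends B) (verts B) M"
  shows "\<exists>H :: ('a, nat) multigraph. multigraph H \<and> is_subdivision 3 H (B :: ('a, 'b) pre_digraph) \<and> mverts H = M"
proof -
  let ?E = "arcs_ends B" and ?V = "verts B"
  note G = graph_arcs_ends[OF assms(1)]
  have sym: "(x, y) \<in> ?E \<Longrightarrow> (y, x) \<in> ?E" for x y using G(1) by (rule symD)
  have M: "M \<subseteq> ?V" "?E \<inter> M \<times> M = {}" using assms(2) by (auto simp: spaced_def)
  obtain m where m: "\<And>v u. v \<in> ?V - M \<Longrightarrow> u \<in> M \<and> (v, u) \<in> ?E \<longleftrightarrow> u = m v"
  proof -
    have "\<forall>v \<in> ?V - M. \<exists>x. \<forall>u. u \<in> M \<and> (v, u) \<in> ?E \<longleftrightarrow> u = x" using assms(2) unfolding spaced_def by metis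
    then show thesis using that by metis
  qed
  obtain q where q: "\<And>v u. v \<in> ?V - M \<Longrightarrow> u \<notin> M \<and> (v, u) \<in> ?E \<longleftrightarrow> u = q v"
  proof -
    have "\<forall>v \<in> ?V - M. \<exists>x. \<forall>u. u \<notin> M \<and> (v, u) \<in> ?E \<longleftrightarrow> u = x" using assms(2) unfolding spaced_def by metis
    then show thesis using that by metis
  qed
  have q_in: "q v \<in> ?V - M" "(v, q v) \<in> ?E" "q v \<noteq> v" and qq: "q (q v) = v" if "v \<in> ?V - M" for v
  proof -
    show vq: "(v, q v) \<in> ?E" and "q v \<in> ?V - M" using q[OF that, of "q v"] G(5) by auto
    then show "q v \<noteq> v" "q (q v) = v" using q[of "q v" v] sym that G(2) by (auto simp: irrefl_def)
  qed
  have m_in: "m v \<in> M" "(v, m v) \<in> ?E" if "v \<in> ?V - M" for v using m[OF that, of "m v"] by auto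
  define K where "K = (\<lambda>v. {v, q v}) ` (?V - M)"
  define N where "N = {0..<card K}"
  have "finite K" using G(4) by (simp add: K_def)
  \<comment> \<open>The orbits are numbered because the edges of \<open>H\<close> have to be natural
    numbers.\<close>
  then obtain g where g: "bij_betw g N K" using ex_bij_betw_nat_finite N_def by blast
  have "\<forall>k \<in> N. \<exists>v \<in> ?V - M. g k = {v, q v}" using bij_betwE[OF g] by (auto simp: K_def)
  \<comment> \<open>Choosing a member of each orbit fixes the direction in which its path is listed;
    \<open>symcl\<close> makes the result independent of it.\<close>
  then obtain a where a: "\<And>k. k \<in> N \<Longrightarrow> a k \<in> ?V - M" "\<And>k. k \<in> N \<Longrightarrow> g k = {a k, q (a k)}" by metis
  have mem: "g k = {x, q x}" if "k \<in> N" "x \<in> {a k, q (a k)}" for k x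
    using that a qq by auto
  have ex: "\<exists>k \<in> N. x = a k \<or> x = q (a k)" if "x \<in> ?V - M" for x
  proof -
    have "{x, q x} \<in> g ` N" using g that by (auto simp: bij_betw_def K_def)
    then show ?thesis using a(2) by auto
  qed
  define P where "P k = [m (a k), a k, q (a k), m (q (a k))]" for k
  define H :: "('a, nat) multigraph" where
    "H = \<lparr>mverts = M, medges = N, mends = \<lambda>k. {m (a k), m (q (a k))}\<rparr>"
  have H: "mverts H = M" "medges H = N" "\<And>k. mends H k = {m (a k), m (q (a k))}" by (simp_all add: H_def)
  have int: "set (internal (P k)) = {a k, q (a k)}" for k by (simp add: internal_def P_def)
  have "multigraph H"
    unfolding multigraph_def H
  proof (intro conjI ballI)
    show "finite M" "finite N" using finite_subset[OF M(1) G(4)] by (auto simp: N_def)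
    show "\<exists>u \<in> M. \<exists>v \<in> M. {m (a k), m (q (a k))} = {u, v}" if "k \<in> N" for k
      using m_in(1) a(1)[OF that] q_in(1) by blast
  qed
  moreover have "is_subdivision 3 H B"
    unfolding is_subdivision_def
  proof (intro exI[of _ P] conjI ballI)
    fix k assume k: "k \<in> medges H"
    show "length (P k) = 3 + 1" "{hd (P k), last (P k)} = mends H k" by (auto simp: P_def H)
    show "distinct (internal (P k))" "set (internal (P k)) \<inter> mverts H = {}"
      using k a(1)[of k] q_in(1)[of "a k"] q_in(3)[of "a k"] by (auto simp: H P_def internal_def)
  next
    show "pairwise (\<lambda>e f. set (internal (P e)) \<inter> set (internal (P f)) = {}) (medges H)"
    proof (rule pairwiseI, rule ccontr)
      fix j k assume jk: "j \<in> medges H" "k \<in> medges H" "j \<noteq> k"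
        "set (internal (P j)) \<inter> set (internal (P k)) \<noteq> {}"
      then have "g j = g k" unfolding int H using mem by blast
      then show False using jk(1-3) g by (auto simp: bij_betw_def inj_on_def H)
    qed
    show "verts B = mverts H \<union> (\<Union>e \<in> medges H. set (internal (P e)))"
    proof
      show "verts B \<subseteq> mverts H \<union> (\<Union>e \<in> medges H. set (internal (P e)))"
        unfolding H int using ex by blast
      show "mverts H \<union> (\<Union>e \<in> medges H. set (internal (P e))) \<subseteq> verts B"
        unfolding H int using M(1) a(1) q_in(1) by blast
    qed
    have arcs: "set (vwalk_arcs (P k)) = {(m (a k), a k), (a k, q (a k)), (q (a k), m (q (a k)))}" for k
      by (simp add: P_def)
    show "?E = symcl (\<Union>e \<in> medges H. set (vwalk_arcs (P e)))" (is "_ = symcl ?A")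
    proof
      have A: "?A \<subseteq> ?E" unfolding arcs H using a(1) q_in m_in sym by blast
      then show "symcl ?A \<subseteq> ?E" unfolding symcl_def using sym by auto
      have half: "(x, m x) \<in> symcl ?A" "(m x, x) \<in> symcl ?A" "(x, q x) \<in> symcl ?A" if "x \<in> ?V - M" for x
      proof -
        obtain k where k: "k \<in> N" "x = a k \<or> x = q (a k)" using ex[OF \<open>x \<in> ?V - M\<close>] by blast
        have "(x, m x) \<in> ?A \<or> (m x, x) \<in> ?A" "(x, q x) \<in> ?A \<or> (q x, x) \<in> ?A"
          using k a(1) qq unfolding arcs H by fastforce+
        then show "(x, m x) \<in> symcl ?A" "(m x, x) \<in> symcl ?A" "(x, q x) \<in> symcl ?A"
          unfolding symcl_def by force+
      qed
      show "?E \<subseteq> symcl ?A"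
      proof (rule subrelI)
        fix x y assume xy: "(x, y) \<in> ?E"
        then have V: "x \<in> ?V" "y \<in> ?V" using G(5) by auto
        show "(x, y) \<in> symcl ?A"
        proof (cases "x \<in> M")
          case True
          then have "y \<in> ?V - M" using M(2) xy V by blast
          moreover then have "x = m y" using m True sym[OF xy] by blast
          ultimately show ?thesis using half by blast
        next
          case False
          then have "y = m x \<or> y = q x" using m[of x y] q[of x y] xy V by blast
          then show ?thesis using half False V by blast
        qed
      qed
    qed
  qed
  ultimately show ?thesis using H(1) by blast
qed

subsection \<open>Blocks\<close>

text \<open>Deleting \<open>f m\<close> leaves a path that starts in \<open>f (m + 1)\<close> and
  reaches all other vertices.\<close>

lemma nonseparable_cyc:
  assumes c: "cyc E n f" and "sym E"
  shows "nonseparable E (range f)"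
proof -
  have n: "n \<ge> 3" using cycD(1)[OF c] .
  have del: "conn_on E (range f - {f m})" for m
  proof -
    let ?R = "E \<inter> (range f - {f m}) \<times> (range f - {f m})"
    have walk: "(f (m + 1), f (m + 1 + int k)) \<in> ?R\<^sup>*" if "int k \<le> n - 2" for k
      using that
    proof (induction k)
      case (Suc k)
      have "f (m + 1 + int k) \<noteq> f m" "f (m + 1 + int k + 1) \<noteq> f m"
        using Suc.prems by (intro cyc_close_neq[OF c]; simp)+
      then have "(f (m + 1 + int k), f (m + 1 + int k + 1)) \<in> ?R" using cycD(3)[OF c] by blast
      moreover have "(f (m + 1), f (m + 1 + int k)) \<in> ?R\<^sup>*" using Suc by simp
      ultimately show ?case by (simp add: ac_simps rtrancl.rtrancl_into_rtrancl)
    qed simp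
    have reach: "(f (m + 1), u) \<in> ?R\<^sup>*" if u: "u \<in> range f - {f m}" for u
    proof -
      obtain i where i: "u = f i" "f i \<noteq> f m" using u by blast
      define k where "k = (i - m) mod n"
      have um: "u = f (m + k)"
        using cyc_mod[OF cyc_shift[OF c, of m], of "i - m"] i by (simp add: k_def add.commute)
      have b: "0 \<le> k" "k < n" using n by (auto simp: k_def)
      have "k \<noteq> 0" using um i by auto
      then have "int (nat (k - 1)) \<le> n - 2" "m + 1 + int (nat (k - 1)) = m + k" using b by auto
      then show ?thesis using walk um by metis
    qed
    have "sym (?R\<^sup>*)" using assms(2) by (intro sym_rtrancl) (auto simp: sym_def)
    then show ?thesis unfolding conn_on_def using reach by (meson rtrancl_trans symD)
  qed
  \<comment> \<open>The whole cycle is the union of two vertex-deleted ones that share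
    \<open>f 2\<close>.\<close>
  have ne: "f 2 \<noteq> f 0" "f 2 \<noteq> f 1" "f 0 \<noteq> f 1" using n by (intro cyc_close_neq[OF c]; simp)+
  have "conn_on E ((range f - {f 0}) \<union> (range f - {f 1}))"
    using ne by (intro conn_on_Un[OF del del, of "f 2"]) auto
  moreover have "(range f - {f 0}) \<union> (range f - {f 1}) = range f" using ne by blast
  ultimately have con: "conn_on E (range f)" by simp
  have "conn_on E (range f - {x})" for x using del con by (cases "x \<in> range f") auto
  then show ?thesis using con unfolding nonseparable_def by blast
qed

text \<open>A walk returning to one of its vertices is cut there. The bound by
  \<open>Range R\<close> records that the path avoids deleted vertices.\<close>

lemma rtrancl_imp_path:
  assumes "(u, v) \<in> R\<^sup>*"
  obtains xs where "xs \<noteq> []" "hd xs = u" "last xs = v" "distinct xs"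
    "successively (\<lambda>x y. (x, y) \<in> R) xs" "set xs \<subseteq> insert u (Range R)"
proof -
  have "\<exists>xs. xs \<noteq> [] \<and> hd xs = u \<and> last xs = v \<and> distinct xs \<and>
    successively (\<lambda>x y. (x, y) \<in> R) xs \<and> set xs \<subseteq> insert u (Range R)"
    using assms
  proof (induction rule: rtrancl_induct)
    case base
    show ?case by (intro exI[of _ "[u]"]) simp
  next
    case (step y z)
    then obtain xs where xs: "xs \<noteq> []" "hd xs = u" "last xs = y" "distinct xs"
      "successively (\<lambda>x y. (x, y) \<in> R) xs" "set xs \<subseteq> insert u (Range R)" by blast
    show ?case
    proof (cases "z \<in> set xs")
      case True
      then obtain as bs where eq: "xs = (as @ [z]) @ bs" using split_list[OF True] by auto
      have "hd (as @ [z]) = u" using xs(2) eq by (cases as) auto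
      moreover have "distinct (as @ [z])" "successively (\<lambda>x y. (x, y) \<in> R) (as @ [z])"
        using xs(4,5) unfolding eq by (metis distinct_append, metis successively_append_iff)
      moreover have "set (as @ [z]) \<subseteq> insert u (Range R)" using xs(6) eq by auto
      ultimately show ?thesis by (intro exI[of _ "as @ [z]"]) simp
    next
      case False
      then show ?thesis using xs step(2)
        by (intro exI[of _ "xs @ [z]"]) (auto simp: successively_append_iff)
    qed
  qed
  then show thesis using that by blast
qed

text \<open>A path from \<open>y\<close> to \<open>z\<close> avoiding \<open>x\<close> is closed
  through \<open>x\<close>.\<close>

lemma cyc_through:
  assumes "sym E" "irrefl E" "(x, y) \<in> E" "(x, z) \<in> E" "y \<noteq> z" "(y, z) \<in> (minus_verts E {x})\<^sup>*"
  obtains n f where "cyc E n f" "f 0 = x" "f 1 = y" "z \<in> range f"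
proof -
  obtain xs where xs: "xs \<noteq> []" "hd xs = y" "last xs = z" "distinct xs"
    "successively (\<lambda>u v. (u, v) \<in> minus_verts E {x}) xs" "set xs \<subseteq> insert y (Range (minus_verts E {x}))"
    using rtrancl_imp_path[OF assms(6)] by blast
  have x: "x \<notin> set xs" using xs(6) assms(2,3) by (auto simp: irrefl_def)
  obtain ys where ys: "xs = y # ys" using xs(1,2) by (cases xs) auto
  have "ys \<noteq> []" using xs(3) ys assms(5) by auto
  then have len: "3 \<le> length (x # xs)" using ys by (cases ys) auto
  have s: "successively (\<lambda>u v. (u, v) \<in> E) (x # xs)"
    using xs(5) ys assms(3) by (auto simp: successively_Cons elim: successively_mono)
  have "distinct (x # xs)" using xs(4) x by simp
  moreover have "(last (x # xs), hd (x # xs)) \<in> E" using xs(1,3) assms(1,4) by (auto dest: symD)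
  ultimately obtain f where f: "cyc E (int (length (x # xs))) f"
      "\<And>i. i < length (x # xs) \<Longrightarrow> f (int i) = (x # xs) ! i"
    using cyc_of_path[OF _ len s] by blast
  show thesis
  proof (rule that[OF f(1)])
    show "f 0 = x" "f 1 = y" using f(2)[of 0] f(2)[of 1] ys by simp_all
    have "f (int (length xs)) = z" using f(2)[of "length xs"] xs(1,3) by (simp add: last_conv_nth nth_Cons')
    then show "z \<in> range f" by blast
  qed
qed

section \<open>Blocks as maximal nonseparable induced subgraphs\<close>

lemma blockD:
  assumes "block G B"
  shows "subgraph B G" "graph B" "nonseparable (arcs_ends B) (verts B)"
  using assms nonseparable_iff[of B] unfolding block_def pre_digraph.max_subgraph_def by auto

text \<open>The subgraph induced by \<open>W\<close> is connected, has no cutvertex and contains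
  \<open>B\<close>, so it cannot be larger.\<close>

lemma block_maximal:
  assumes "graph G" "block G B" "nonseparable (arcs_ends G) W" "verts B \<subseteq> W" "W \<subseteq> verts G"
  shows "B = G \<restriction> W"
proof (rule ccontr)
  assume ne: "B \<noteq> G \<restriction> W"
  interpret graph G by fact
  have ind: "induced_subgraph (G \<restriction> W) G" using assms(5) by blast
  have g: "graph (G \<restriction> W)" using assms(1) ind by (rule graph_induced)
  have P: "connected (G \<restriction> W) \<and> (\<nexists>x. cutvertex (G \<restriction> W) x)"
    unfolding nonseparable_iff[OF g] using assms(3) by (simp add: arcs_ends_induce nonseparable_restrict)
  have sub: "subgraph B G" using blockD(1)[OF assms(2)] .
  have "subgraph B (G \<restriction> W)"
  proof (rule subgraphI)
    have "tail B e \<in> W" "head B e \<in> W" if "e \<in> arcs B" for e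
      using sub that assms(4) by (auto elim!: subgraphE dest: wf_digraph.wellformed)
    moreover have "tail B = tail G" "head B = head G" "arcs B \<subseteq> arcs G"
      using sub by (simp_all add: subgraph_def compatible_def)
    ultimately show "arcs B \<subseteq> arcs (G \<restriction> W)" by auto
  qed (use sub assms(4) in \<open>auto elim!: subgraphE simp: compatible_def\<close>)
  moreover have "subgraph (G \<restriction> W) G" using ind by (rule induced_imp_subgraph)
  moreover have "H \<noteq> B \<and> subgraph B H \<longrightarrow> \<not> (subgraph H G \<and> graph H \<and> connected H \<and> (\<nexists>x. cutvertex H x))" for H
    using assms(2) unfolding block_def pre_digraph.max_subgraph_def by simp
  ultimately show False using ne g P by metis
qed

lemma block_induced:
  assumes "graph G" "block G B"
  shows "B = G \<restriction> verts B"
proof (rule block_maximal[OF assms])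
  show "nonseparable (arcs_ends G) (verts B)"
    using blockD(3)[OF assms(2)] arcs_ends_mono[OF blockD(1)[OF assms(2)]] by (rule nonseparable_mono)
  show "verts B \<subseteq> verts G" using blockD(1)[OF assms(2)] by (auto elim: subgraphE)
qed simp

lemma block_exists:
  assumes "graph G" "nonseparable (arcs_ends G) W" "W \<subseteq> verts G"
  obtains B where "block G B" "W \<subseteq> verts B"
proof -
  interpret graph G by fact
  define \<W> where "\<W> = {A. nonseparable (arcs_ends G) A \<and> A \<subseteq> verts G}"
  have "finite \<W>" unfolding \<W>_def by simp
  moreover have "W \<in> \<W>" using assms by (simp add: \<W>_def)
  ultimately have "\<exists>A \<in> \<W>. W \<subseteq> A \<and> (\<forall>C \<in> \<W>. A \<subseteq> C \<longrightarrow> A = C)"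
    by (rule finite_has_maximal2)
  then obtain A where A: "A \<in> \<W>" "W \<subseteq> A" "\<forall>C \<in> \<W>. A \<subseteq> C \<longrightarrow> A = C" by blast
  have ind: "induced_subgraph (G \<restriction> A) G" using A(1) by (auto simp: \<W>_def)
  have g: "graph (G \<restriction> A)" using assms(1) ind by (rule graph_induced)
  have P: "connected (G \<restriction> A) \<and> (\<nexists>x. cutvertex (G \<restriction> A) x)"
    unfolding nonseparable_iff[OF g] using A(1) by (simp add: arcs_ends_induce nonseparable_restrict \<W>_def)
  have "block G (G \<restriction> A)"
    unfolding block_def pre_digraph.max_subgraph_def
  proof (intro conjI allI impI notI)
    show "subgraph (G \<restriction> A) G" using ind by blast
    show "graph (G \<restriction> A)" by fact
    show "connected (G \<restriction> A)" "\<exists>x. cutvertex (G \<restriction> A) x \<Longrightarrow> False" using P by blast+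
    fix H assume H1: "H \<noteq> G \<restriction> A \<and> subgraph (G \<restriction> A) H"
      and H2: "subgraph H G \<and> graph H \<and> connected H \<and> (\<nexists>x. cutvertex H x)"
    have "nonseparable (arcs_ends G) (verts H)"
      using H2 nonseparable_iff[of H] arcs_ends_mono[of H G] nonseparable_mono by blast
    then have "verts H \<in> \<W>" using H2 by (auto simp: \<W>_def elim: subgraphE)
    moreover have "A \<subseteq> verts H" using H1 by (auto elim!: subgraphE)
    ultimately have V: "verts H = A" using A(3) by blast
    have c: "tail H = tail G" "head H = head G"
      using H2 by (auto elim!: subgraphE simp: compatible_def)
    have "arcs H \<subseteq> arcs (G \<restriction> A)"
    proof
      fix e assume e: "e \<in> arcs H"
      then have "tail H e \<in> A" "head H e \<in> A"
        using H2 V wf_digraph.wellformed[of H e] by (auto elim!: subgraphE)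
      then show "e \<in> arcs (G \<restriction> A)" using e c H2 by (auto elim!: subgraphE)
    qed
    moreover have "arcs (G \<restriction> A) \<subseteq> arcs H" using H1 by (blast elim: subgraphE)
    ultimately have "H = G \<restriction> A" using V c by (intro pre_digraph.equality) auto
    then show False using H1 by blast
  qed
  then show thesis using that A(2) by simp
qed

lemma cutvertex_of_block_exit:
  assumes "graph G" "block G B" "(x, a) \<in> arcs_ends G" "a \<notin> verts B" "(x, z) \<in> arcs_ends B"
  shows "cutvertex G x"
proof (rule ccontr)
  let ?E = "arcs_ends G"
  assume no: "\<not> cutvertex G x"
  note G = graph_arcs_ends[OF assms(1)]
  have B: "x \<in> verts B" "z \<in> verts B" "x \<noteq> z"
    using graph_arcs_ends[OF blockD(2)[OF assms(2)]] assms(5) by (auto simp: irrefl_def)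
  have xz: "(x, z) \<in> ?E" using arcs_ends_mono[OF blockD(1)[OF assms(2)]] assms(5) by blast
  have "a \<in> verts G - {x}" "z \<in> verts G - {x}" "x \<in> verts G" "a \<noteq> z"
    using assms(3,4) xz G B by (auto simp: irrefl_def)
  moreover have "(a, z) \<in> ?E\<^sup>*"
    using assms(3) xz G(1) by (meson converse_rtrancl_into_rtrancl r_into_rtrancl symD)
  ultimately have "(a, z) \<in> (minus_verts ?E {x})\<^sup>*"
    using no unfolding cutvertex_iff[OF assms(1)] by blast
  then obtain n f where f: "cyc ?E n f" "f 0 = x" "f 1 = a" "z \<in> range f"
    using cyc_through[OF G(1,2) assms(3) xz \<open>a \<noteq> z\<close>] by blast
  let ?W = "verts B \<union> range f"
  have "nonseparable ?E (verts B)"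
    using blockD(3)[OF assms(2)] arcs_ends_mono[OF blockD(1)[OF assms(2)]] by (rule nonseparable_mono)
  moreover have "x \<in> verts B \<inter> range f" "z \<in> verts B \<inter> range f" using f B by auto
  ultimately have "nonseparable ?E ?W" using nonseparable_Un nonseparable_cyc[OF f(1) G(1)] B(3) by metis
  moreover have "?W \<subseteq> verts G"
    using cyc_Field[OF f(1)] G(6) blockD(1)[OF assms(2)] by (auto elim: subgraphE)
  ultimately have "B = G \<restriction> ?W" using block_maximal[OF assms(1,2)] by blast
  then have "range f \<subseteq> verts B" by (metis Un_upper2 induce_subgraph_verts)
  then show False using f(3) assms(4) by blast
qed

lemma trivial_block_iff:
  assumes "graph B" "nonseparable (arcs_ends B) (verts B)"
  shows "trivial_block B \<longleftrightarrow> card (verts B) < 3"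
proof
  assume "trivial_block B"
  then show "card (verts B) < 3" by (auto simp: trivial_block_def complete_digraph_def)
next
  let ?E = "arcs_ends B" and ?V = "verts B"
  note G = graph_arcs_ends[OF assms(1)]
  assume lt: "card ?V < 3"
  have "?V \<noteq> {}" using assms(2) by (simp add: nonseparable_def)
  then have "card ?V \<noteq> 0" using G(4) by simp
  then consider "card ?V = 1" | "card ?V = 2" using lt by linarith
  then show "trivial_block B"
  proof cases
    case 1
    then obtain x where "?V = {x}" by (auto simp: card_1_singleton_iff)
    then have "?E = {(u, v). (u, v) \<in> ?V \<times> ?V \<and> u \<noteq> v}" using G(2,5) by (auto simp: irrefl_def)
    then show ?thesis using 1 assms(1) by (auto simp: trivial_block_def complete_digraph_def)
  next
    case 2
    then obtain x y where xy: "?V = {x, y}" "x \<noteq> y" by (auto simp: card_2_iff)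
    then have "(x, y) \<in> ?E\<^sup>*" using assms(2) G(5) by (auto simp: nonseparable_def conn_on_def Int_absorb2)
    then obtain w where "(x, w) \<in> ?E" using xy(2) by (auto elim: converse_rtranclE)
    then have "(x, y) \<in> ?E" using G(2,5) xy by (auto simp: irrefl_def)
    then have "?E = {(u, v). (u, v) \<in> ?V \<times> ?V \<and> u \<noteq> v}"
      using G(1,2,5) xy by (auto simp: irrefl_def dest: symD)
    then show ?thesis using 2 assms(1) by (auto simp: trivial_block_def complete_digraph_def)
  qed
qed

lemma cyc_spaced_pattern:
  assumes c: "cyc E n f" and "sym E" and "range f \<subseteq> V" and M: "spaced E V M"
  obtains r where "\<And>i. f i \<in> M \<longleftrightarrow> 3 dvd i - r"
proof (rule exactly_one_in_three[of "\<lambda>i. f i \<in> M"])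
  fix i
  have E: "(f (i + 1), f i) \<in> E" "(f (i + 1), f (i + 2)) \<in> E"
    using cycD(3)[OF c, of i] cycD(3)[OF c, of "i + 1"] assms(2) by (auto simp: add.assoc dest: symD)
  have ne: "f i \<noteq> f (i + 2)" using cycD(1)[OF c] by (intro cyc_close_neq[OF c]) auto
  show "(of_bool (f i \<in> M) + of_bool (f (i + 1) \<in> M) + of_bool (f (i + 2) \<in> M) :: int) = 1"
  proof (cases "f (i + 1) \<in> M")
    case True
    then have "f i \<notin> M" "f (i + 2) \<notin> M" using M E by (auto simp: spaced_def)
    then show ?thesis using True by simp
  next
    case False
    then have "\<exists>!u. u \<in> M \<and> (f (i + 1), u) \<in> E" "\<exists>!w. w \<notin> M \<and> (f (i + 1), w) \<in> E"
      using M assms(3) unfolding spaced_def by blast+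
    then have "f i \<in> M \<longleftrightarrow> f (i + 2) \<notin> M" using E ne by metis
    then show ?thesis using False by auto
  qed
qed (use that in blast)

lemma class_H3_imp_mod3_cycles:
  assumes "G \<in> class_H3"
  shows "mod3_cycles (arcs_ends G)"
  unfolding mod3_cycles_def
proof (intro allI impI)
  let ?E = "arcs_ends G"
  fix n f assume c: "cyc ?E n f"
  have g: "graph G" using assms by (simp add: class_H3_def)
  note G = graph_arcs_ends[OF g]
  have n: "n \<ge> 3" using cycD(1)[OF c] .
  obtain B where B: "block G B" "range f \<subseteq> verts B"
    using block_exists[OF g nonseparable_cyc[OF c G(1)]] cyc_Field[OF c] G(6) by blast
  note GB = graph_arcs_ends[OF blockD(2)[OF B(1)]]
  have "card (range f) \<le> card (verts B)" using B(2) GB(4) by (intro card_mono)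
  then have "\<not> trivial_block B"
    using trivial_block_iff[OF blockD(2,3)[OF B(1)]] cyc_range(4)[OF c] n by simp
  then obtain H :: "('a, nat) multigraph" where H: "multigraph H" "is_subdivision 3 H B"
      "\<forall>x \<in> verts B. cutvertex G x \<longrightarrow> x \<in> mverts H"
    using assms B(1) unfolding class_H3_def by blast
  define M where "M = mverts H"
  have M: "spaced (arcs_ends B) (verts B) M" unfolding M_def using H(1,2) by (rule subdivision_imp_spaced)
  have EB: "arcs_ends B = ?E \<inter> verts B \<times> verts B"
    using block_induced[OF g B(1)] arcs_ends_induce by metis
  have cB: "cyc (arcs_ends B) n f" unfolding EB using c B(2) by (rule cyc_restrict)
  obtain r where r: "\<And>i. f i \<in> M \<longleftrightarrow> 3 dvd i - r"
    using cyc_spaced_pattern[OF cB GB(1) B(2) M] by blast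
  have br: "f i \<in> M" if b: "branching ?E (f i)" for i
  proof (rule ccontr)
    assume i: "f i \<notin> M"
    then have "\<exists>!u. u \<in> M \<and> (f i, u) \<in> arcs_ends B" "\<exists>!w. w \<notin> M \<and> (f i, w) \<in> arcs_ends B"
      using M B(2) unfolding spaced_def by blast+
    then obtain u w where uw: "\<And>y. (f i, y) \<in> arcs_ends B \<Longrightarrow> y = u \<or> y = w" by metis
    obtain a where a: "(f i, a) \<in> ?E" "a \<noteq> u" "a \<noteq> w" using b unfolding branching_def by blast
    then have "a \<notin> verts B" using uw B(2) unfolding EB by blast
    then have "cutvertex G (f i)"
      using cutvertex_of_block_exit[OF g B(1) a(1)] cycD(3)[OF cB] by blast
    then show False using H(3) B(2) i unfolding M_def by blast
  qed
  have "f (r + n) = f r" by (subst cycD(2)[OF c]) simp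
  then have "3 dvd n" using r[of r] r[of "r + n"] by simp
  moreover have "3 dvd i - j" if "branching ?E (f i)" "branching ?E (f j)" for i j
    using br[OF that(1)] br[OF that(2)] r[of i] r[of j] by presburger
  ultimately show "3 dvd n \<and> (\<forall>i j. branching ?E (f i) \<and> branching ?E (f j) \<longrightarrow> 3 dvd i - j)" by blast
qed

subsection \<open>Spaced sets in nonseparablearable graphs\<close>

lemma card_ge_3_ex_other:
  assumes "3 \<le> card W"
  shows "\<exists>t \<in> W. t \<noteq> u \<and> t \<noteq> v"
proof (rule ccontr)
  assume "\<not> ?thesis"
  then have "card W \<le> card {u, v}" by (intro card_mono) auto
  then show False using assms card_insert_le_m1[of 2 "{v}" u] by simp
qed

lemma cyc_through_edge:
  assumes "sym F" "irrefl F" "F \<subseteq> W \<times> W" "nonseparable F W" "3 \<le> card W" "(u, v) \<in> F"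
  obtains n f where "cyc F n f" "f 0 = u" "f 1 = v"
proof -
  have uv: "u \<in> W" "v \<in> W" "u \<noteq> v" using assms(2,3,6) by (auto simp: irrefl_def)
  obtain t where t: "t \<in> W" "t \<noteq> u" "t \<noteq> v" using card_ge_3_ex_other[OF assms(5)] by blast
  have con: "conn_on F (W - {x})" for x using assms(4) by (simp add: nonseparable_def)
  have "(u, t) \<in> (F \<inter> (W - {v}) \<times> (W - {v}))\<^sup>*" using con uv t unfolding conn_on_def by blast
  then obtain w where w: "(u, w) \<in> F" "w \<in> W" "w \<noteq> v" using t(2) by (auto elim: converse_rtranclE)
  have "w \<noteq> u" using w(1) assms(2) by (auto simp: irrefl_def)
  then have "(v, w) \<in> (F \<inter> (W - {u}) \<times> (W - {u}))\<^sup>*" using con uv w unfolding conn_on_def by blast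
  moreover have "F \<inter> (W - {u}) \<times> (W - {u}) \<subseteq> minus_verts F {u}" by blast
  ultimately have "(v, w) \<in> (minus_verts F {u})\<^sup>*" using rtrancl_mono by blast
  then show thesis using cyc_through[OF assms(1,2,6) w(1)] w(3) that by metis
qed

text \<open>
  Two cycles that agree at one step agree backwards until they reach D, because the vertices outside
  D have only two neighbours.  Hence being congruent to D modulo 3 does not depend on the cycle.
\<close>

lemma cyc_aligned:
  assumes f: "cyc F n f" and g: "cyc F n' g" and "sym F"
    and meet: "f i = g j" "f (i + 1) = g (j + 1)"
    and s: "f s \<in> D" and t: "g t \<in> D"
    and nb: "\<And>x. x \<in> range f \<Longrightarrow> x \<notin> D \<Longrightarrow> \<not> branching F x"
    and D: "\<forall>n f i j. cyc F n f \<and> f i \<in> D \<and> f j \<in> D \<longrightarrow> 3 dvd i - j"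
  shows "3 dvd i - s \<longleftrightarrow> 3 dvd j - t"
proof -
  have n: "n \<ge> 3" "n' \<ge> 3" using cycD(1)[OF f] cycD(1)[OF g] .
  have "f (i - (i - s) mod n) = f s"
    using dvd_minus_mod[of n "i - s"] by (subst cycD(2)[OF f]) (simp add: algebra_simps)
  moreover have "int (nat ((i - s) mod n)) = (i - s) mod n" using n by simp
  ultimately have ex: "\<exists>k. f (i - int k) \<in> D" using s by metis
  define k where "k = (LEAST k. f (i - int k) \<in> D)"
  have k: "f (i - int k) \<in> D" and least: "\<And>l. l < k \<Longrightarrow> f (i - int l) \<notin> D"
    unfolding k_def using LeastI_ex[OF ex] not_less_Least by blast+
  have "f (i - int l) = g (j - int l) \<and> f (i - int l + 1) = g (j - int l + 1)" if "l \<le> k" for l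
    using that
  proof (induction l)
    case (Suc l)
    then have IH: "f (i - int l) = g (j - int l)" "f (i - int l + 1) = g (j - int l + 1)" by auto
    have "\<not> branching F (f (i - int l))" using least[of l] Suc.prems nb by auto
    moreover have "(f (i - int l), g (j - int l - 1)) \<in> F"
      using cyc_prev[OF g, of "j - int l"] IH(1) assms(3) by (auto dest: symD)
    ultimately have "g (j - int l - 1) = f (i - int l - 1) \<or> g (j - int l - 1) = g (j - int l + 1)"
      using cyc_non_branching[OF f assms(3)] IH(2) by metis
    moreover have "g (j - int l - 1) \<noteq> g (j - int l + 1)" using n by (intro cyc_close_neq[OF g]) auto
    ultimately show ?case using IH(1) by (simp add: algebra_simps)
  qed (use meet in simp)
  then have "g (j - int k) \<in> D" using k by simp
  then have "3 dvd i - int k - s" "3 dvd j - int k - t" using D f g k s t by blast+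
  then show ?thesis by presburger
qed

lemma spaced_exists:
  assumes "mod3_cycles E" "F \<subseteq> E" "sym F" "irrefl F" "F \<subseteq> W \<times> W" "nonseparable F W" "3 \<le> card W"
  obtains M where "spaced F W M" "\<And>x. x \<in> W \<Longrightarrow> branching E x \<Longrightarrow> x \<in> M"
proof -
  have gF: "mod3_cycles F" using assms(1,2) by (rule mod3_cycles_mono)
  have con: "conn_on F W" and ne: "W \<noteq> {}" using assms(6) by (auto simp: nonseparable_def)
  have Fs: "(x, y) \<in> F \<Longrightarrow> (y, x) \<in> F" for x y using assms(3) by (rule symD)
  obtain D where D: "D \<subseteq> W" "D \<noteq> {}" "\<And>x. x \<in> W \<Longrightarrow> branching E x \<Longrightarrow> x \<in> D"
    "\<forall>n f i j. cyc F n f \<and> f i \<in> D \<and> f j \<in> D \<longrightarrow> 3 dvd i - j"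
  proof (cases "\<exists>x \<in> W. branching E x")
    case True
    show ?thesis
    proof (rule that[of "{x \<in> W. branching E x}"])
      show "\<forall>n f i j. cyc F n f \<and> f i \<in> {x \<in> W. branching E x} \<and> f j \<in> {x \<in> W. branching E x} \<longrightarrow> 3 dvd i - j"
        using mod3_cyclesD(2)[OF assms(1) cyc_mono[OF _ assms(2)]] by blast
    qed (use True in auto)
  next
    case False
    obtain x where x: "x \<in> W" using ne by blast
    show ?thesis
    proof (rule that[of "{x}"])
      show "\<forall>n f i j. cyc F n f \<and> f i \<in> {x} \<and> f j \<in> {x} \<longrightarrow> 3 dvd i - j"
      proof (intro allI impI)
        fix n f i j assume f: "cyc F n f \<and> f i \<in> {x} \<and> f j \<in> {x}"
        then have "n dvd i - j" using cycD(2)[of F n f i j] by simp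
        then show "3 dvd i - j" using mod3_cyclesD(1)[OF gF] f dvd_trans by blast
      qed
    qed (use False x in auto)
  qed
  have nbF: "\<not> branching F x" if "x \<in> W" "x \<notin> D" for x
    using D(3) that branching_mono[OF _ assms(2)] by blast
  have rangeW: "range f \<subseteq> W" if "cyc F n f" for n f
    using cyc_Field[OF that] assms(5) by (auto simp: Field_def)
  have meetD: "\<exists>t. f t \<in> D" if f: "cyc F n f" for n f
  proof (rule ccontr)
    assume no: "\<nexists>t. f t \<in> D"
    have step: "y \<in> range f" if xy: "x \<in> range f" "(x, y) \<in> F" for x y
    proof -
      obtain i where i: "x = f i" using xy(1) by blast
      have "\<not> branching F (f i)" using nbF no rangeW[OF f] by blast
      then show ?thesis using cyc_non_branching[OF f assms(3)] xy(2) i by blast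
    qed
    obtain d where d: "d \<in> D" using D(2) by blast
    have "(f 0, d) \<in> (F \<inter> W \<times> W)\<^sup>*" using con rangeW[OF f] d D(1) unfolding conn_on_def by blast
    then have "d \<in> range f" by (induction rule: rtrancl_induct) (use step in blast)+
    then show False using no d by blast
  qed
  define M where "M = {v. \<exists>n f i s. cyc F n f \<and> f s \<in> D \<and> 3 dvd i - s \<and> f i = v}"
  have M_iff: "g j \<in> M \<longleftrightarrow> 3 dvd j - t" if g: "cyc F n' g" "g t \<in> D" for n' g j t
  proof
    assume "g j \<in> M"
    then obtain n f i s where f: "cyc F n f" "f s \<in> D" "3 dvd i - s" "f i = g j" unfolding M_def by blast
    have nbf: "\<not> branching F x" if "x \<in> range f" "x \<notin> D" for x using nbF rangeW[OF f(1)] that by blast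
    note al = cyc_aligned[OF f(1) _ assms(3) _ _ f(2) _ nbf D(4)]
    show "3 dvd j - t"
    proof (cases "g j \<in> D")
      case True
      then show ?thesis using D(4) g by blast
    next
      case False
      have "\<not> branching F (g j)" using nbF False rangeW[OF g(1)] by blast
      moreover have "(g j, f (i + 1)) \<in> F" using cycD(3)[OF f(1), of i] f(4) by simp
      ultimately consider "f (i + 1) = g (j - 1)" | "f (i + 1) = g (j + 1)"
        using cyc_non_branching[OF g(1) assms(3)] by blast
      then show ?thesis
      proof cases
        case 1
        have "3 dvd i - s \<longleftrightarrow> 3 dvd - j - (- t)"
          by (rule al[OF cyc_reverse[OF g(1) assms(3)]]) (use f g 1 in auto)
        then show ?thesis using f(3) by presburger
      next
        case 2
        have "3 dvd i - s \<longleftrightarrow> 3 dvd j - t" by (rule al[OF g(1)]) (use f g 2 in auto)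
        then show ?thesis using f(3) by simp
      qed
    qed
  qed (use g in \<open>unfold M_def, blast\<close>)
  have edge: "\<exists>n f. cyc F n f \<and> f 0 = u \<and> f 1 = v" if "(u, v) \<in> F" for u v
    using cyc_through_edge[OF assms(3-7) that] by metis
  have nbr: "\<exists>y. (x, y) \<in> F" if "x \<in> W" for x
  proof -
    obtain t where "t \<in> W" "t \<noteq> x" using card_ge_3_ex_other[OF assms(7)] by blast
    then have "(x, t) \<in> (F \<inter> W \<times> W)\<^sup>*" "t \<noteq> x" using con \<open>x \<in> W\<close> unfolding conn_on_def by blast+
    then show ?thesis by (auto elim: converse_rtranclE)
  qed
  have DM: "x \<in> M" if x: "x \<in> D" for x
  proof -
    obtain n f where f: "cyc F n f" "f 0 = x" using nbr edge D(1) x by blast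
    then show ?thesis using M_iff[OF f(1), of 0 0] x by simp
  qed
  have "spaced F W M"
    unfolding spaced_def
  proof (intro conjI ballI)
    show "M \<subseteq> W" unfolding M_def using rangeW by blast
    show "F \<inter> M \<times> M = {}"
    proof (rule ccontr)
      assume "F \<inter> M \<times> M \<noteq> {}"
      then obtain u v where uv: "(u, v) \<in> F" "u \<in> M" "v \<in> M" by blast
      then obtain n f where f: "cyc F n f" "f 0 = u" "f 1 = v" using edge by blast
      obtain t where "f t \<in> D" using meetD[OF f(1)] by blast
      then have "3 dvd 0 - t" "3 dvd 1 - t" using M_iff[OF f(1)] f uv by blast+
      then show False by presburger
    qed
    fix v assume v: "v \<in> W - M"
    then obtain n f where f: "cyc F n f" "f 0 = v" using nbr edge by blast
    obtain t where t: "f t \<in> D" using meetD[OF f(1)] by blast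
    note iff = M_iff[OF f(1) t]
    have "\<not> branching F (f 0)" using v DM nbF f(2) by blast
    then have nb: "(v, y) \<in> F \<longleftrightarrow> y = f (-1) \<or> y = f 1" for y
      using cyc_non_branching[OF f(1) assms(3), of 0 y] f(2) cycD(3)[OF f(1), of 0]
        Fs[OF cyc_prev[OF f(1), of 0]] by auto
    have "\<not> 3 dvd 0 - t" using iff[of 0] f(2) v by auto
    then have "f 1 \<in> M \<longleftrightarrow> f (-1) \<notin> M" using iff[of 1] iff[of "-1"] by presburger
    then show "\<exists>!u. u \<in> M \<and> (v, u) \<in> F" "\<exists>!w. w \<notin> M \<and> (v, w) \<in> F" using nb by metis+
  qed
  then show thesis using that D(3) DM by blast
qed

lemma not_cutvertex:
  assumes "graph G"
    and nbrs: "\<And>y z. (x, y) \<in> arcs_ends G \<Longrightarrow> (x, z) \<in> arcs_ends G \<Longrightarrow> (y, z) \<in> (minus_verts (arcs_ends G) {x})\<^sup>*"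
  shows "\<not> cutvertex G x"
proof
  let ?E = "arcs_ends G" and ?R = "(minus_verts (arcs_ends G) {x})\<^sup>*"
  assume "cutvertex G x"
  then obtain u v where uv: "u \<noteq> x" "v \<noteq> x" "(u, v) \<in> ?E\<^sup>*" "(u, v) \<notin> ?R"
    unfolding cutvertex_iff[OF assms(1)] by blast
  have E: "sym ?E" using graph_arcs_ends(1)[OF assms(1)] .
  have "if y = x then \<exists>z. (x, z) \<in> ?E \<and> (u, z) \<in> ?R else (u, y) \<in> ?R" if "(u, y) \<in> ?E\<^sup>*" for y
    using that
  proof (induction rule: rtrancl_induct)
    case base
    then show ?case using uv(1) by simp
  next
    case (step y z)
    show ?case
    proof (cases "y = x")
      case True
      then obtain w where "(x, w) \<in> ?E" "(u, w) \<in> ?R" using step.IH by auto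
      then show ?thesis using nbrs[of w z] step(2) True by (auto intro: rtrancl_trans)
    next
      case False
      then have y: "(u, y) \<in> ?R" using step.IH by simp
      show ?thesis
      proof (cases "z = x")
        case True
        then show ?thesis using y step(2) E by (auto dest: symD)
      next
        case False
        then have "(y, z) \<in> minus_verts ?E {x}" using step(2) \<open>y \<noteq> x\<close> by blast
        then show ?thesis using y False by (simp add: rtrancl.rtrancl_into_rtrancl)
      qed
    qed
  qed
  from this[OF uv(3)] show False using uv(2,4) by simp
qed

lemma mod3_cycles_imp_class_H3:
  assumes g: "graph G" and "mod3_cycles (arcs_ends G)"
  shows "G \<in> class_H3"
  unfolding class_H3_def
proof (intro CollectI conjI allI impI)
  show "graph G" by fact
  let ?E = "arcs_ends G"
  note G = graph_arcs_ends[OF g]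
  fix B assume "block G B \<and> \<not> trivial_block B"
  then have B: "block G B" "\<not> trivial_block B" by auto
  let ?F = "arcs_ends B" and ?W = "verts B"
  note F = graph_arcs_ends[OF blockD(2)[OF B(1)]]
  have FE: "?F \<subseteq> ?E" using arcs_ends_mono[OF blockD(1)[OF B(1)]] .
  have N: "nonseparable ?F ?W" using blockD(3)[OF B(1)] .
  have card: "3 \<le> card ?W" using B(2) trivial_block_iff[OF blockD(2,3)[OF B(1)]] by simp
  obtain M where M: "spaced ?F ?W M" "\<And>x. x \<in> ?W \<Longrightarrow> branching ?E x \<Longrightarrow> x \<in> M"
    using spaced_exists[OF assms(2) FE F(1,2,5) N card] by blast
  obtain H :: "('a, nat) multigraph" where H: "multigraph H" "is_subdivision 3 H B" "mverts H = M"
    using spaced_imp_subdivision[OF blockD(2)[OF B(1)] M(1)] by blast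
  have "branching ?E x" if "x \<in> ?W" "cutvertex G x" for x
  proof (rule ccontr)
    assume nb: "\<not> branching ?E x"
    have W: "conn_on ?F (?W - {x})" "conn_on ?F ?W" using N by (auto simp: nonseparable_def)
    obtain t where "t \<in> ?W" "t \<noteq> x" using card_ge_3_ex_other[OF card] by blast
    then have "(x, t) \<in> (?F \<inter> ?W \<times> ?W)\<^sup>*" "t \<noteq> x" using W(2) \<open>x \<in> ?W\<close> unfolding conn_on_def by blast+
    then obtain y where "(x, y) \<in> ?F" by (auto elim: converse_rtranclE)
    then obtain n f where f: "cyc ?F n f" "f 0 = x"
      using cyc_through_edge[OF F(1,2,5) N card] by metis
    have f': "f i \<in> ?W" for i using cyc_Field[OF f(1)] F(6) by blast
    have sub: "(?F \<inter> (?W - {x}) \<times> (?W - {x}))\<^sup>* \<subseteq> (minus_verts ?E {x})\<^sup>*"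
      using FE by (intro rtrancl_mono) blast
    have "f 1 \<noteq> x" "f (-1) \<noteq> x"
      using f(2) cycD(1)[OF f(1)] cyc_close_neq[OF f(1), of 1 0] cyc_close_neq[OF f(1), of "-1" 0] by auto
    then have "{f 1, f (-1)} \<subseteq> ?W - {x}" using f' by blast
    then have con: "(y, z) \<in> (minus_verts ?E {x})\<^sup>*" if "y \<in> {f 1, f (-1)}" "z \<in> {f 1, f (-1)}" for y z
      using W(1) that sub unfolding conn_on_def by (meson subsetD)
    have "y \<in> {f 1, f (-1)}" if "(x, y) \<in> ?E" for y
      using cyc_non_branching[OF cyc_mono[OF f(1) FE] G(1), of 0 y] nb f(2) that by auto
    then have "\<not> cutvertex G x" by (intro not_cutvertex[OF g] con)
    then show False using \<open>cutvertex G x\<close> by simp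
  qed
  then show "\<exists>H :: ('a, nat) multigraph. multigraph H \<and> is_subdivision 3 H B \<and>
      (\<forall>x \<in> verts B. cutvertex G x \<longrightarrow> x \<in> mverts H)"
    using H M(2) by blast
qed

theorem theorem5:
  shows "(class_G3 :: ('a, 'b) pre_digraph set) = class_H3"
proof -
  have "graph G" if "G \<in> class_H3" for G :: "('a, 'b) pre_digraph"
    using that by (simp add: class_H3_def)
  then show ?thesis using class_G3_iff class_H3_imp_mod3_cycles mod3_cycles_imp_class_H3 by blast
qed

end
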